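(* Let $k\in\{2,\ldots,n\}$ and let $(M,g;\mathcal D_1,\ldots,\mathcal D_k)$ be an $n$-dimensional Riemannian almost $k$-product manifold. Then $$\operatorname{div} X = 2\,\mathrm S_{\rm mix}(\mathcal D_1,\ldots,\mathcal D_k)+\sum_{r\in\{1,k-1\}}\ \sum_{\boldsymbol q\in S(r,k)}\big(\|h_{\boldsymbol q}\|^2-\|H_{\boldsymbol q}\|^2-\|T_{\boldsymbol q}\|^2\big),$$ where $X=\sum_{r\in\{1,k-1\}}\sum_{\boldsymbol q\in S(r,k)}H_{\boldsymbol q}$.
   Context: A Riemannian almost $k$-product manifold $(M,g;\mathcal D_1,\ldots,\mathcal D_k)$ is a Riemannian manifold $(M,g)$, $g=\langle\cdot,\cdot\rangle$, $\dim M=n$, with Levi-Civita connection $\nabla$, endowed with $k$ pairwise orthogonal smooth distributions (subbundles of $TM$) $\mathcal D_i$ of dimensions $n_i\ge1$ with $\sum_i n_i=\dim M$, so that $TM=\bigoplus_i\mathcal D_i$. Mixed scalar curvature: $\mathrm S_{\rm mix}(\mathcal D_1,\ldots,\mathcal D_k)=\sum_{i<j}\mathrm K(\mathcal D_i,\mathcal D_j)$, where $\mathrm K(\mathcal D_i,\mathcal D_j)=\sum_{a,b}\langle R(e_a,\varepsilon_b)e_a,\varepsilon_b\rangle$ for local orthonormal frames $(e_a)$ of $\mathcal D_i$ and $(\varepsilon_b)$ of $\mathcal D_j$; the sign convention for the curvature tensor $R$ is such that $\langle R(x,y)x,y\rangle$ is the sectional curvature of the plane spanned by orthonormal $x,y$.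 $S(r,k)$ is the set of all $r$-element subsets $\boldsymbol q=\{q_1<\ldots<q_r\}$ of $\{1,\ldots,k\}$. For $\boldsymbol q\in S(r,k)$ put $\mathcal D_{\boldsymbol q}=\bigoplus_{i\in\boldsymbol q}\mathcal D_i$, and let $\widehat P_{\boldsymbol q}$ be the orthogonal projector of $TM$ onto $\mathcal D_{\boldsymbol q}^\perp$. For sections $Y,Z$ of $\mathcal D_{\boldsymbol q}$, the second fundamental form and the integrability tensor of $\mathcal D_{\boldsymbol q}$ are $h_{\boldsymbol q}(Y,Z)=\tfrac12\widehat P_{\boldsymbol q}(\nabla_YZ+\nabla_ZY)$ and $T_{\boldsymbol q}(Y,Z)=\tfrac12\widehat P_{\boldsymbol q}(\nabla_YZ-\nabla_ZY)=\tfrac12\widehat P_{\boldsymbol q}[Y,Z]$; the mean curvature vector field is $H_{\boldsymbol q}=\operatorname{Tr}_g h_{\boldsymbol q}=\sum_a h_{\boldsymbol q}(E_a,E_a)$ for a local orthonormal frame $(E_a)$ of $\mathcal D_{\boldsymbol q}$. Norms are $\|h_{\boldsymbol q}\|^2=\sum_{a,b}\|h_{\boldsymbol q}(E_a,E_b)\|^2$ and $\|T_{\boldsymbol q}\|^2=\sum_{a,b}\|T_{\boldsymbol q}(E_a,E_b)\|^2$.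
   Formalization: The sum over r in {1,k-1} is taken as two terms, r=1 and r=k-1, so for k=2 the single value r=1 is counted twice (also in X); read as a set sum, the formula fails for k=2, e.g. on the round 2-sphere minus its poles with meridians and parallels (1 = 2). *)

theory Defs
  imports "HOL-Analysis.Analysis" "HOL-Library.Function_Algebras"
begin

text \<open>Together with \<^theory>\<open>HOL-Library.Function_Algebras\<close>, the following instance makes tangent vectors
  and vector fields (both are functions below) elements of real vector spaces with pointwise
  operations.\<close>

instantiation "fun" :: (type, real_vector) real_vector
begin

definition scaleR_fun_def: "r *\<^sub>R f = (\<lambda>x. r *\<^sub>R f x)"

instance
  by standard (simp_all add: scaleR_fun_def fun_eq_iff algebra_simps)

end

lemma scaleR_fun_apply [simp]: "(r *\<^sub>R f) x = r *\<^sub>R f x"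
  by (simp add: scaleR_fun_def)


section \<open>Smooth manifolds\<close>

text \<open>Both predicates are only used on open sets \<open>S\<close>.\<close>

fun C_k_on :: "nat \<Rightarrow> (real^'n) set \<Rightarrow> (real^'n \<Rightarrow> 'b::real_normed_vector) \<Rightarrow> bool" where
  "C_k_on 0 S f \<longleftrightarrow> continuous_on S f"
| "C_k_on (Suc k) S f \<longleftrightarrow> f differentiable_on S \<and>
     (\<forall>i. C_k_on k S (\<lambda>x. frechet_derivative f (at x) (axis i 1)))"

definition smooth_on :: "(real^'n) set \<Rightarrow> (real^'n \<Rightarrow> 'b::real_normed_vector) \<Rightarrow> bool" where
  "smooth_on S f \<longleftrightarrow> (\<forall>k. C_k_on k S f)"

text \<open>A chart is a pair of its domain and its coordinate map.\<close>

type_synonym ('a, 'n) chart = "'a set \<times> ('a \<Rightarrow> real^'n)"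

definition chart_inv :: "('a, 'n) chart \<Rightarrow> real^'n \<Rightarrow> 'a" where
  "chart_inv c = inv_into (fst c) (snd c)"

definition transition :: "('a, 'n) chart \<Rightarrow> ('a, 'n) chart \<Rightarrow> real^'n \<Rightarrow> real^'n" where
  "transition c c' = (\<lambda>x. snd c' (chart_inv c x))"

text \<open>A tangent vector at \<open>p\<close> is represented by the family of its component vectors with respect to
  the charts around \<open>p\<close>; the components are related by the differentials of the transition maps.
  The value at all other charts is 0, so that equal tangent vectors are equal functions.\<close>

type_synonym ('a, 'n) tvec = "('a, 'n) chart \<Rightarrow> real^'n"
type_synonym ('a, 'n) vfield = "'a \<Rightarrow> ('a, 'n) tvec"

record ('a, 'n) riem =
  topol :: "'a topology"
  atlas :: "('a, 'n) chart set"
  metric :: "'a \<Rightarrow> ('a, 'n) tvec \<Rightarrow> ('a, 'n) tvec \<Rightarrow> real"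

definition smooth_manifold :: "('a, 'n::finite) riem \<Rightarrow> bool" where
  "smooth_manifold M \<longleftrightarrow>
     Hausdorff_space (topol M) \<and> second_countable (topol M) \<and>
     (\<forall>c\<in>atlas M. openin (topol M) (fst c) \<and> open (snd c ` fst c) \<and>
        homeomorphic_map (subtopology (topol M) (fst c)) (top_of_set (snd c ` fst c)) (snd c)) \<and>
     (\<Union>c\<in>atlas M. fst c) = topspace (topol M) \<and>
     (\<forall>c\<in>atlas M. \<forall>c'\<in>atlas M. smooth_on (snd c ` (fst c \<inter> fst c')) (transition c c'))"

definition charts_at :: "('a, 'n::finite) riem \<Rightarrow> 'a \<Rightarrow> ('a, 'n) chart set" where
  "charts_at M p = {c \<in> atlas M. p \<in> fst c}"

definition tangent_space :: "('a, 'n::finite) riem \<Rightarrow> 'a \<Rightarrow> ('a, 'n) tvec set" where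
  "tangent_space M p = {v.
     (\<forall>c. c \<notin> charts_at M p \<longrightarrow> v c = 0) \<and>
     (\<forall>c\<in>charts_at M p. \<forall>c'\<in>charts_at M p.
        v c' = frechet_derivative (transition c c') (at (snd c p)) (v c))}"

text \<open>Smooth functions and smooth vector fields on an open subset \<open>U\<close> of the manifold; their values
  outside of \<open>U\<close> are irrelevant.\<close>

definition smooth_fun :: "('a, 'n::finite) riem \<Rightarrow> 'a set \<Rightarrow> ('a \<Rightarrow> real) \<Rightarrow> bool" where
  "smooth_fun M U f \<longleftrightarrow>
     (\<forall>c\<in>atlas M. smooth_on (snd c ` (fst c \<inter> U)) (\<lambda>x. f (chart_inv c x)))"

definition vector_fields :: "('a, 'n::finite) riem \<Rightarrow> 'a set \<Rightarrow> ('a, 'n) vfield set" where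
  "vector_fields M U = {X.
     (\<forall>p\<in>U. X p \<in> tangent_space M p) \<and>
     (\<forall>c\<in>atlas M. smooth_on (snd c ` (fst c \<inter> U)) (\<lambda>x. X (chart_inv c x) c))}"

text \<open>The derivative \<open>v(f)\<close> of a function by a tangent vector, read in an arbitrary chart
  around \<open>p\<close>; it does not depend on the chart.\<close>

definition dir_deriv :: "('a, 'n::finite) riem \<Rightarrow> 'a \<Rightarrow> ('a, 'n) tvec \<Rightarrow> ('a \<Rightarrow> real) \<Rightarrow> real" where
  "dir_deriv M p v f = (let c = (SOME c. c \<in> charts_at M p) in
     frechet_derivative (\<lambda>x. f (chart_inv c x)) (at (snd c p)) (v c))"

text \<open>In coordinates, \<open>[X,Y]\<^sup>i = X\<^sup>j \<partial>\<^sub>j Y\<^sup>i - Y\<^sup>j \<partial>\<^sub>j X\<^sup>i\<close>.\<close>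

definition lie_bracket :: "('a, 'n::finite) riem \<Rightarrow> ('a, 'n) vfield \<Rightarrow> ('a, 'n) vfield \<Rightarrow> ('a, 'n) vfield" where
  "lie_bracket M X Y = (\<lambda>p c. if c \<in> charts_at M p then
       frechet_derivative (\<lambda>x. Y (chart_inv c x) c) (at (snd c p)) (X p c)
     - frechet_derivative (\<lambda>x. X (chart_inv c x) c) (at (snd c p)) (Y p c)
     else 0)"


section \<open>Riemannian manifolds\<close>

definition riemannian_manifold :: "('a, 'n::finite) riem \<Rightarrow> bool" where
  "riemannian_manifold M \<longleftrightarrow> smooth_manifold M \<and>
     (\<forall>p\<in>topspace (topol M). \<forall>u\<in>tangent_space M p. \<forall>v\<in>tangent_space M p.
        metric M p u v = metric M p v u \<and>
        (\<forall>w\<in>tangent_space M p. metric M p (u + v) w = metric M p u w + metric M p v w) \<and>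
        (\<forall>r. metric M p (r *\<^sub>R u) v = r * metric M p u v) \<and>
        (u \<noteq> 0 \<longrightarrow> metric M p u u > 0)) \<and>
     (\<forall>U X Y. openin (topol M) U \<and> X \<in> vector_fields M U \<and> Y \<in> vector_fields M U \<longrightarrow>
        smooth_fun M U (\<lambda>p. metric M p (X p) (Y p)))"

text \<open>A connection is taken as an operator on local vector fields, where \<open>nabla X Y\<close> stands
  for the covariant derivative of \<open>Y\<close> along \<open>X\<close>.\<close>

definition affine_connection ::
  "('a, 'n::finite) riem \<Rightarrow> (('a, 'n) vfield \<Rightarrow> ('a, 'n) vfield \<Rightarrow> ('a, 'n) vfield) \<Rightarrow> bool" where
  "affine_connection M nabla \<longleftrightarrow>
     (\<forall>U. openin (topol M) U \<longrightarrow>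
       (\<forall>X\<in>vector_fields M U. \<forall>Y\<in>vector_fields M U.
          nabla X Y \<in> vector_fields M U \<and>
          (\<forall>Z\<in>vector_fields M U. \<forall>p\<in>U.
             nabla (X + Z) Y p = nabla X Y p + nabla Z Y p \<and>
             nabla X (Y + Z) p = nabla X Y p + nabla X Z p) \<and>
          (\<forall>f. smooth_fun M U f \<longrightarrow> (\<forall>p\<in>U.
             nabla (\<lambda>q. f q *\<^sub>R X q) Y p = f p *\<^sub>R nabla X Y p \<and>
             nabla X (\<lambda>q. f q *\<^sub>R Y q) p = dir_deriv M p (X p) f *\<^sub>R Y p + f p *\<^sub>R nabla X Y p))))"

definition levi_civita_connection ::
  "('a, 'n::finite) riem \<Rightarrow> (('a, 'n) vfield \<Rightarrow> ('a, 'n) vfield \<Rightarrow> ('a, 'n) vfield) \<Rightarrow> bool" where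
  "levi_civita_connection M nabla \<longleftrightarrow> affine_connection M nabla \<and>
     (\<forall>U. openin (topol M) U \<longrightarrow>
       (\<forall>X\<in>vector_fields M U. \<forall>Y\<in>vector_fields M U. \<forall>p\<in>U.
          nabla X Y p - nabla Y X p = lie_bracket M X Y p \<and>
          (\<forall>Z\<in>vector_fields M U.
             dir_deriv M p (X p) (\<lambda>q. metric M q (Y q) (Z q)) =
               metric M p (nabla X Y p) (Z p) + metric M p (Y p) (nabla X Z p))))"

text \<open>The sign is such that \<open>\<langle>R(x,y)x,y\<rangle>\<close> is the sectional curvature for orthonormal
  \<open>x\<close>, \<open>y\<close>.\<close>

definition curvature ::
  "('a, 'n::finite) riem \<Rightarrow> (('a, 'n) vfield \<Rightarrow> ('a, 'n) vfield \<Rightarrow> ('a, 'n) vfield) \<Rightarrow>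
   ('a, 'n) vfield \<Rightarrow> ('a, 'n) vfield \<Rightarrow> ('a, 'n) vfield \<Rightarrow> ('a, 'n) vfield" where
  "curvature M nabla X Y Z =
     nabla Y (nabla X Z) - nabla X (nabla Y Z) + nabla (lie_bracket M X Y) Z"


section \<open>Distributions\<close>

type_synonym ('a, 'n) distr = "'a \<Rightarrow> ('a, 'n) tvec set"

definition distribution :: "('a, 'n::finite) riem \<Rightarrow> nat \<Rightarrow> ('a, 'n) distr \<Rightarrow> bool" where
  "distribution M m D \<longleftrightarrow>
     (\<forall>p\<in>topspace (topol M). subspace (D p) \<and> D p \<subseteq> tangent_space M p \<and> dim (D p) = m \<and>
        (\<exists>U E. openin (topol M) U \<and> p \<in> U \<and> (\<forall>a<m. E a \<in> vector_fields M U) \<and>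
           (\<forall>q\<in>U. span ((\<lambda>a. E a q) ` {..<m}) = D q)))"

definition orthonormal_frame ::
  "('a, 'n::finite) riem \<Rightarrow> ('a, 'n) distr \<Rightarrow> 'a set \<Rightarrow> nat \<Rightarrow> (nat \<Rightarrow> ('a, 'n) vfield) \<Rightarrow> bool" where
  "orthonormal_frame M D U m E \<longleftrightarrow>
     (\<forall>a<m. E a \<in> vector_fields M U) \<and>
     (\<forall>q\<in>U. span ((\<lambda>a. E a q) ` {..<m}) = D q \<and>
        (\<forall>a<m. \<forall>b<m. metric M q (E a q) (E b q) = (if a = b then 1 else 0)))"

text \<open>A local orthonormal frame of \<open>D\<close> around \<open>p\<close>, indexed by \<open>{..<dim (D p)}\<close>. Every smooth
  distribution has one, and the quantities defined below do not depend on the choice.\<close>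

definition frame_at ::
  "('a, 'n::finite) riem \<Rightarrow> ('a, 'n) distr \<Rightarrow> 'a \<Rightarrow> nat \<Rightarrow> ('a, 'n) vfield" where
  "frame_at M D p =
     (SOME E. \<exists>U. openin (topol M) U \<and> p \<in> U \<and> orthonormal_frame M D U (dim (D p)) E)"

definition perp_proj :: "('a, 'n::finite) riem \<Rightarrow> ('a, 'n) distr \<Rightarrow> 'a \<Rightarrow> ('a, 'n) tvec \<Rightarrow> ('a, 'n) tvec" where
  "perp_proj M D p v =
     (THE w. w \<in> tangent_space M p \<and> (\<forall>u\<in>D p. metric M p w u = 0) \<and> v - w \<in> D p)"

context
  fixes M :: "('a, 'n::finite) riem"
    and nabla :: "('a, 'n) vfield \<Rightarrow> ('a, 'n) vfield \<Rightarrow> ('a, 'n) vfield"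
begin

definition second_fundamental_form ::
  "('a, 'n) distr \<Rightarrow> ('a, 'n) vfield \<Rightarrow> ('a, 'n) vfield \<Rightarrow> ('a, 'n) vfield" where
  "second_fundamental_form D Y Z = (\<lambda>p. (1/2) *\<^sub>R perp_proj M D p (nabla Y Z p + nabla Z Y p))"

definition integrability_tensor ::
  "('a, 'n) distr \<Rightarrow> ('a, 'n) vfield \<Rightarrow> ('a, 'n) vfield \<Rightarrow> ('a, 'n) vfield" where
  "integrability_tensor D Y Z = (\<lambda>p. (1/2) *\<^sub>R perp_proj M D p (nabla Y Z p - nabla Z Y p))"

definition mean_curvature :: "('a, 'n) distr \<Rightarrow> ('a, 'n) vfield" where
  "mean_curvature D = (\<lambda>p. let E = frame_at M D p in
     \<Sum>a<dim (D p). second_fundamental_form D (E a) (E a) p)"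

text \<open>The squared norm at \<open>p\<close> of a bilinear map \<open>B\<close> on \<open>D\<close> with values in the tangent bundle.\<close>

definition form_norm2 ::
  "('a, 'n) distr \<Rightarrow> (('a, 'n) vfield \<Rightarrow> ('a, 'n) vfield \<Rightarrow> ('a, 'n) vfield) \<Rightarrow> 'a \<Rightarrow> real" where
  "form_norm2 D B p = (let E = frame_at M D p in
     \<Sum>a<dim (D p). \<Sum>b<dim (D p). metric M p (B (E a) (E b) p) (B (E a) (E b) p))"

definition divergence :: "('a, 'n) vfield \<Rightarrow> 'a \<Rightarrow> real" where
  "divergence X p = (let E = frame_at M (tangent_space M) p in
     \<Sum>a<dim (tangent_space M p). metric M p (nabla (E a) X p) (E a p))"

definition mixed_curvature :: "('a, 'n) distr \<Rightarrow> ('a, 'n) distr \<Rightarrow> 'a \<Rightarrow> real" where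
  "mixed_curvature D D' p = (let E = frame_at M D p; F = frame_at M D' p in
     \<Sum>a<dim (D p). \<Sum>b<dim (D' p). metric M p (curvature M nabla (E a) (F b) (E a) p) (F b p))"

definition mixed_scalar_curvature :: "nat \<Rightarrow> (nat \<Rightarrow> ('a, 'n) distr) \<Rightarrow> 'a \<Rightarrow> real" where
  "mixed_scalar_curvature k D p =
     (\<Sum>(i, j) | 1 \<le> i \<and> i < j \<and> j \<le> k. mixed_curvature (D i) (D j) p)"

end

definition almost_product :: "('a, 'n::finite) riem \<Rightarrow> nat \<Rightarrow> (nat \<Rightarrow> ('a, 'n) distr) \<Rightarrow> bool" where
  "almost_product M k D \<longleftrightarrow> riemannian_manifold M \<and>
     (\<exists>d :: nat \<Rightarrow> nat.
        (\<forall>i\<in>{1..k}. d i \<ge> 1 \<and> distribution M (d i) (D i)) \<and> (\<Sum>i=1..k. d i) = CARD('n)) \<and>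
     (\<forall>i\<in>{1..k}. \<forall>j\<in>{1..k}. i \<noteq> j \<longrightarrow>
        (\<forall>p\<in>topspace (topol M). \<forall>u\<in>D i p. \<forall>v\<in>D j p. metric M p u v = 0))"

text \<open>Sums over \<open>r \<in> {1, k - 1}\<close> of terms indexed by these sets are to be taken over the list
  \<open>[1, k - 1]\<close>: one summand for single distributions and one for their orthogonal complements.
  For \<open>k = 2\<close> both values of \<open>r\<close> coincide and have to be counted twice.\<close>

definition index_sets :: "nat \<Rightarrow> nat \<Rightarrow> nat set set" where
  "index_sets r k = {q. q \<subseteq> {1..k} \<and> card q = r}"

definition sum_distr :: "(nat \<Rightarrow> ('a, 'n::finite) distr) \<Rightarrow> nat set \<Rightarrow> ('a, 'n) distr" where
  "sum_distr D q = (\<lambda>p. span (\<Union>i\<in>q. D i p))"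

end

theory Submission
  imports Defs
begin

text \<open>Around \<open>p\<close> take an orthonormal frame \<open>E\<close> of \<open>TM\<close> adapted to all \<open>D i\<close>, with connection coefficients
  \<open>\<omega> x y z = \<langle>\<nabla>\<^bsub>E x\<^esub> (E y), E z\<rangle>\<close>, skew in \<open>y, z\<close>. For a set \<open>A\<close> of frame indices with complement \<open>N\<close>,
  the distribution spanned by \<open>A\<close> has \<open>H = \<Sum>z\<in>N. (\<Sum>s\<in>A. \<omega> s s z) E z\<close> and
  \<open>\<parallel>h\<parallel>\<^sup>2 - \<parallel>T\<parallel>\<^sup>2 = \<Sum>z\<in>N. \<Sum>s,t\<in>A. \<omega> s t z \<omega> t s z\<close>. Expanding \<open>\<langle>R(E x, E y) E x, E y\<rangle>\<close> for \<open>x\<in>A\<close>, \<open>y\<in>N\<close>,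
  the second derivatives sum up to the divergences of the two mean curvature fields and the rest is an
  algebraic identity in \<open>\<omega>\<close>: this is Walczak's formula for a pair of complementary distributions.
  The claim is its sum over the pairs of \<open>D i\<close> and its orthogonal complement; every mixed curvature
  then occurs twice because \<open>\<langle>R(x,y)x,y\<rangle>\<close> is symmetric.

  The members of the frame along \<open>D i\<close> are the frame chosen in the definition of the mixed curvature, and the inner
  products of frame fields are constant; so neither the tensoriality of \<open>R\<close> nor the
  symmetry of second derivatives is needed.\<close>

section \<open>Smooth functions\<close>

text \<open>The last premise is \<open>C_k_on_cong\<close> for \<open>k\<close>, whose induction step relies on this rule.\<close>

lemma C_k_on_SucI:
  fixes f :: "real^'n \<Rightarrow> 'b::real_normed_vector"
  assumes "open S" "\<And>x. x \<in> S \<Longrightarrow> (f has_derivative f' x) (at x)"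
    and "\<And>i. C_k_on k S (\<lambda>x. f' x (axis i 1))"
    and cong: "\<And>g h :: real^'n \<Rightarrow> 'b. (\<And>x. x \<in> S \<Longrightarrow> g x = h x) \<Longrightarrow> C_k_on k S g \<Longrightarrow> C_k_on k S h"
  shows "C_k_on (Suc k) S f"
proof -
  have "frechet_derivative f (at x) = f' x" if "x \<in> S" for x
    using frechet_derivative_at[OF assms(2)[OF that]] by simp
  then have "C_k_on k S (\<lambda>x. frechet_derivative f (at x) (axis i 1))" for i
    by (intro cong[OF _ assms(3)[of i]]) simp
  moreover have "f differentiable_on S"
    using assms(2) by (meson differentiable_at_imp_differentiable_on differentiable_def)
  ultimately show ?thesis by simp
qed

lemma C_k_on_has_derivative:
  assumes "C_k_on (Suc k) S f" "open S" "x \<in> S"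
  shows "(f has_derivative frechet_derivative f (at x)) (at x)"
proof -
  have "f differentiable_on S" using assms(1) by simp
  then have "f differentiable (at x)"
    using assms(2,3) by (simp add: differentiable_on_eq_differentiable_at)
  then show ?thesis by (simp add: frechet_derivative_works)
qed

lemma C_k_on_cong:
  assumes "open S" "\<And>x. x \<in> S \<Longrightarrow> f x = g x" "C_k_on k S f"
  shows "C_k_on k S g"
  using assms(2,3)
proof (induction k arbitrary: f g)
  case 0
  then show ?case by (simp cong: continuous_on_cong)
next
  case (Suc k)
  have "(f has_derivative frechet_derivative f (at x)) (at x)" if "x \<in> S" for x
    using C_k_on_has_derivative[OF Suc.prems(2) assms(1) that] .
  then have "(g has_derivative frechet_derivative f (at x)) (at x)" if "x \<in> S" for x
    using has_derivative_transform_within_open[OF _ assms(1) that] Suc.prems(1) that by blast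
  moreover have "C_k_on k S (\<lambda>x. frechet_derivative f (at x) (axis i 1))" for i
    using Suc.prems(2) by simp
  ultimately show ?case
    by (rule C_k_on_SucI[OF assms(1) _ _ Suc.IH])
qed

lemma C_k_on_SucI':
  assumes "open S" "\<And>x. x \<in> S \<Longrightarrow> (f has_derivative f' x) (at x)"
    and "\<And>i. C_k_on k S (\<lambda>x. f' x (axis i 1))"
  shows "C_k_on (Suc k) S f"
  by (rule C_k_on_SucI[OF assms C_k_on_cong[OF assms(1)]])

lemma C_k_on_Suc_D: "C_k_on (Suc k) S f \<Longrightarrow> C_k_on k S f"
  by (induction k arbitrary: f) (simp_all add: differentiable_imp_continuous_on)

lemma C_k_on_const: "C_k_on k S (\<lambda>x. c)"
  by (induction k arbitrary: c) auto

lemma C_k_on_add: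
  assumes "open S" "C_k_on k S f" "C_k_on k S g"
  shows "C_k_on k S (\<lambda>x. f x + g x)"
  using assms(2,3)
proof (induction k arbitrary: f g)
  case 0
  then show ?case by (simp add: continuous_on_add)
next
  case (Suc k)
  note d = has_derivative_add[OF C_k_on_has_derivative[OF Suc.prems(1) assms(1)]
      C_k_on_has_derivative[OF Suc.prems(2) assms(1)]]
  show ?case
    by (rule C_k_on_SucI'[OF assms(1) d]) (use Suc assms(1) in auto)
qed

text \<open>The product rule pairs each derivative with the other factor undifferentiated. The
  induction hypothesis thus meets factors of order \<open>Suc k\<close>, which are first lowered to
  order \<open>k\<close>.\<close>

lemma C_k_on_scaleR:
  fixes f :: "real^'n \<Rightarrow> real" and g :: "real^'n \<Rightarrow> 'b::real_normed_vector"
  assumes "open S" "C_k_on k S f" "C_k_on k S g"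
  shows "C_k_on k S (\<lambda>x. f x *\<^sub>R g x)"
  using assms(2,3)
proof (induction k arbitrary: f g)
  case 0
  then show ?case by (simp add: continuous_on_scaleR)
next
  case (Suc k)
  note d = has_derivative_scaleR[OF C_k_on_has_derivative[OF Suc.prems(1) assms(1)]
      C_k_on_has_derivative[OF Suc.prems(2) assms(1)]]
  have "C_k_on k S (\<lambda>x. f x *\<^sub>R frechet_derivative g (at x) (axis i 1)
      + frechet_derivative f (at x) (axis i 1) *\<^sub>R g x)" for i
    using Suc.prems by (intro C_k_on_add[OF assms(1)] Suc.IH) (auto intro: C_k_on_Suc_D)
  then show ?case
    by (intro C_k_on_SucI'[OF assms(1) d])
qed

text \<open>The exponent varies in the induction because differentiation lowers it by 1. The case
  \<open>a = - 1/2\<close> normalizes vector fields in the Gram-Schmidt process.\<close>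

lemma C_k_on_powr:
  fixes f :: "real^'n \<Rightarrow> real"
  assumes "open S" "C_k_on k S f" "\<And>x. x \<in> S \<Longrightarrow> f x > 0"
  shows "C_k_on k S (\<lambda>x. f x powr a)"
  using assms(2)
proof (induction k arbitrary: a)
  case 0
  then show ?case using assms(3) by (force intro!: continuous_intros)
next
  case (Suc k)
  have d: "((\<lambda>x. f x powr a) has_derivative
      (\<lambda>v. (a * f x powr (a - 1)) *\<^sub>R frechet_derivative f (at x) v)) (at x)" if "x \<in> S" for x
    using has_derivative_powr[OF C_k_on_has_derivative[OF Suc.prems assms(1) that]
        has_derivative_const[of a] assms(3)[OF that]] assms(3)[OF that]
    by (simp add: powr_diff field_simps)
  have p: "C_k_on k S (\<lambda>x. a *\<^sub>R f x powr (a - 1))"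
    by (intro C_k_on_scaleR C_k_on_const assms(1) Suc.IH C_k_on_Suc_D[OF Suc.prems])
  have "C_k_on k S (\<lambda>x. (a * f x powr (a - 1)) *\<^sub>R frechet_derivative f (at x) (axis i 1))" for i
    using C_k_on_scaleR[OF assms(1) p, of "\<lambda>x. frechet_derivative f (at x) (axis i 1)"] Suc.prems by simp
  then show ?case
    by (intro C_k_on_SucI'[OF assms(1) d])
qed

lemma smooth_on_cong:
  "open S \<Longrightarrow> (\<And>x. x \<in> S \<Longrightarrow> f x = g x) \<Longrightarrow> smooth_on S f \<Longrightarrow> smooth_on S g"
  unfolding smooth_on_def by (blast intro: C_k_on_cong)

lemma smooth_on_const: "smooth_on S (\<lambda>x. c)"
  by (simp add: smooth_on_def C_k_on_const)

lemma smooth_on_add: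
  "open S \<Longrightarrow> smooth_on S f \<Longrightarrow> smooth_on S g \<Longrightarrow> smooth_on S (\<lambda>x. f x + g x)"
  by (simp add: smooth_on_def C_k_on_add)

lemma smooth_on_scaleR:
  fixes f :: "real^'n \<Rightarrow> real"
  shows "open S \<Longrightarrow> smooth_on S f \<Longrightarrow> smooth_on S g \<Longrightarrow> smooth_on S (\<lambda>x. f x *\<^sub>R g x)"
  by (simp add: smooth_on_def C_k_on_scaleR)

lemma smooth_on_powr:
  fixes f :: "real^'n \<Rightarrow> real"
  shows "open S \<Longrightarrow> smooth_on S f \<Longrightarrow> (\<And>x. x \<in> S \<Longrightarrow> f x > 0) \<Longrightarrow> smooth_on S (\<lambda>x. f x powr a)"
  by (simp add: smooth_on_def C_k_on_powr)

lemma smooth_on_differentiable: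
  assumes "smooth_on S f" "open S" "x \<in> S"
  shows "f differentiable (at x)"
  using assms C_k_on_has_derivative[of 0 S f x] unfolding smooth_on_def differentiable_def by blast

lemma smooth_on_subset:
  assumes "smooth_on S f" "open S" "open T" "T \<subseteq> S"
  shows "smooth_on T f"
proof -
  have "C_k_on k S f \<Longrightarrow> C_k_on k T f" for k
    by (induction k arbitrary: f)
      (use assms in \<open>auto intro: continuous_on_subset differentiable_on_subset\<close>)
  then show ?thesis using assms(1) unfolding smooth_on_def by blast
qed

section \<open>Vector fields and the Levi-Civita connection\<close>

lemma sum_fun_apply: "(\<Sum>i\<in>A. f i) x = (\<Sum>i\<in>A. f i x)"
  by (induction A rule: infinite_finite_induct) auto

locale riemannian_connection =
  fixes M :: "('a, 'n::finite) riem"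
    and nabla :: "('a, 'n) vfield \<Rightarrow> ('a, 'n) vfield \<Rightarrow> ('a, 'n) vfield"
  assumes riem: "riemannian_manifold M"
    and lc: "levi_civita_connection M nabla"
begin

abbreviation "opn \<equiv> openin (topol M)"
abbreviation "TM \<equiv> tangent_space M"
abbreviation "VF \<equiv> vector_fields M"
abbreviation "g \<equiv> metric M"

lemma open_topspace: "opn U \<Longrightarrow> p \<in> U \<Longrightarrow> p \<in> topspace (topol M)"
  using openin_subset by blast

section \<open>Charts, transition maps and tangent spaces\<close>

lemma manifold: "smooth_manifold M"
  using riem by (simp add: riemannian_manifold_def)

lemma chart:
  assumes "c \<in> atlas M"
  shows chart_domain_open: "opn (fst c)" and chart_range_open: "open (snd c ` fst c)"
    and chart_homeomorphic:
      "homeomorphic_map (subtopology (topol M) (fst c)) (top_of_set (snd c ` fst c)) (snd c)"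
  using manifold assms unfolding smooth_manifold_def by simp_all

text \<open>A homeomorphism is an open map onto its range, and the range is open in the coordinate
  space. Smoothness over \<open>U\<close> is tested on these images, and derivatives at their points
  can be taken because they are open.\<close>

lemma chart_image_open:
  assumes "c \<in> atlas M" "opn U"
  shows "open (snd c ` (fst c \<inter> U))"
proof -
  have "openin (subtopology (topol M) (fst c)) (fst c \<inter> U)"
    using assms(2) by (auto simp: openin_subtopology)
  then have "openin (top_of_set (snd c ` fst c)) (snd c ` (fst c \<inter> U))"
    using homeomorphic_imp_open_map[OF chart_homeomorphic[OF assms(1)]] by (simp add: open_map_def)
  then show ?thesis using openin_open_eq[OF chart_range_open[OF assms(1)]] by blast
qed

lemma chart_inj:
  assumes "c \<in> atlas M"
  shows "inj_on (snd c) (fst c)"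
  using homeomorphic_imp_injective_map[OF chart_homeomorphic[OF assms]]
    openin_subset[OF chart_domain_open[OF assms]]
  by (simp add: Int_absorb1)

lemma chart_inv_simp [simp]: "c \<in> atlas M \<Longrightarrow> p \<in> fst c \<Longrightarrow> chart_inv c (snd c p) = p"
  by (simp add: chart_inv_def chart_inj)

lemma charts_atD: "c \<in> charts_at M p \<Longrightarrow> c \<in> atlas M \<and> p \<in> fst c"
  by (simp add: charts_at_def)

lemma charts_at_nonempty: "p \<in> topspace (topol M) \<Longrightarrow> \<exists>c. c \<in> charts_at M p"
  using manifold unfolding smooth_manifold_def charts_at_def by blast

text \<open>The transition map is smooth on the open image of the chart overlap, hence
  differentiable at \<open>snd c p\<close>. Linearity of its differential makes the compatibility
  condition in \<open>tangent_space\<close> a linear one.\<close>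

lemma transition_linear:
  assumes "c \<in> charts_at M p" "c' \<in> charts_at M p"
  shows "linear (frechet_derivative (transition c c') (at (snd c p)))"
proof -
  have c: "c \<in> atlas M" "p \<in> fst c" "c' \<in> atlas M" "p \<in> fst c'"
    using assms by (auto dest: charts_atD)
  have "opn (fst c')" "smooth_on (snd c ` (fst c \<inter> fst c')) (transition c c')"
    using chart_domain_open c manifold unfolding smooth_manifold_def by simp_all
  then have "transition c c' differentiable (at (snd c p))"
    using c by (intro smooth_on_differentiable[of "snd c ` (fst c \<inter> fst c')"] chart_image_open) auto
  then show ?thesis by (rule linear_frechet_derivative)
qed

lemma TM_transition:
  "v \<in> TM p \<Longrightarrow> c \<in> charts_at M p \<Longrightarrow> c' \<in> charts_at M p \<Longrightarrow>
    v c' = frechet_derivative (transition c c') (at (snd c p)) (v c)"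
  unfolding tangent_space_def by blast

lemma TM_outside: "v \<in> TM p \<Longrightarrow> c \<notin> charts_at M p \<Longrightarrow> v c = 0"
  unfolding tangent_space_def by blast

lemma TM_I:
  assumes "\<And>c. c \<notin> charts_at M p \<Longrightarrow> v c = 0"
    and "\<And>c c'. c \<in> charts_at M p \<Longrightarrow> c' \<in> charts_at M p \<Longrightarrow>
      v c' = frechet_derivative (transition c c') (at (snd c p)) (v c)"
  shows "v \<in> TM p"
  unfolding tangent_space_def using assms by blast

lemma subspace_TM: "subspace (TM p)"
proof (rule subspaceI)
  show "0 \<in> TM p"
    using linear_0[OF transition_linear] by (auto simp: tangent_space_def)
next
  fix u v assume uv: "u \<in> TM p" "v \<in> TM p"
  show "u + v \<in> TM p"
  proof (rule TM_I)
    show "(u + v) c = 0" if "c \<notin> charts_at M p" for c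
      using TM_outside[OF uv(1) that] TM_outside[OF uv(2) that] by simp
  next
    show "(u + v) c' = frechet_derivative (transition c c') (at (snd c p)) ((u + v) c)"
      if c: "c \<in> charts_at M p" "c' \<in> charts_at M p" for c c'
      using TM_transition[OF uv(1) c] TM_transition[OF uv(2) c] linear_add[OF transition_linear[OF c]]
      by (metis plus_fun_apply)
  qed
next
  fix r u assume u: "u \<in> TM p"
  show "r *\<^sub>R u \<in> TM p"
  proof (rule TM_I)
    show "(r *\<^sub>R u) c = 0" if "c \<notin> charts_at M p" for c
      using TM_outside[OF u that] by simp
  next
    show "(r *\<^sub>R u) c' = frechet_derivative (transition c c') (at (snd c p)) ((r *\<^sub>R u) c)"
      if c: "c \<in> charts_at M p" "c' \<in> charts_at M p" for c c'
      using TM_transition[OF u c] linear_scale[OF transition_linear[OF c]]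
      by (metis scaleR_fun_apply)
  qed
qed

text \<open>Evaluation in one chart around \<open>p\<close> is linear and injective on
  \<open>TM p\<close>: the transition rule and the default value 0 determine all other components.
  So an independent set in \<open>TM p\<close> maps to an independent set in
  \<open>real^'n\<close>.\<close>

lemma TM_independent_card:
  assumes p: "p \<in> topspace (topol M)" and B: "B \<subseteq> TM p" "independent B"
  shows "finite B \<and> card B \<le> CARD('n)"
proof -
  obtain c where c: "c \<in> charts_at M p" using charts_at_nonempty[OF p] by blast
  define f where "f = (\<lambda>v :: ('a, 'n) tvec. v c)"
  have lin: "linear f" unfolding f_def by (intro linearI) auto
  have "u = v" if "u \<in> TM p" "v \<in> TM p" "f u = f v" for u v
  proof
    fix c' show "u c' = v c'"
      using that c TM_transition TM_outside unfolding f_def by (cases "c' \<in> charts_at M p") metis+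
  qed
  then have inj: "inj_on f (span B)"
    by (intro inj_onI) (use span_minimal[OF B(1) subspace_TM] in blast)
  have ind: "independent (f ` B)"
    by (rule linear_independent_injective_image[OF lin B(2) inj])
  have "inj_on f B" using inj span_superset by (rule inj_on_subset)
  then show ?thesis
    using independent_card_le[OF ind] independent_imp_finite[OF ind] finite_image_iff card_image
    by fastforce
qed

section \<open>Bilinear algebra of the metric on a tangent space\<close>

lemma metric_axioms:
  assumes "p \<in> topspace (topol M)" "u \<in> TM p" "v \<in> TM p"
  shows g_sym: "g p u v = g p v u"
    and g_add_left: "w \<in> TM p \<Longrightarrow> g p (u + v) w = g p u w + g p v w"
    and g_scale_left: "g p (r *\<^sub>R u) v = r * g p u v"
    and g_pos: "u \<noteq> 0 \<Longrightarrow> g p u u > 0"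
  using riem assms unfolding riemannian_manifold_def by blast+

lemma g_add_right:
  assumes "p \<in> topspace (topol M)" "u \<in> TM p" "v \<in> TM p" "w \<in> TM p"
  shows "g p u (v + w) = g p u v + g p u w"
  using assms subspace_add[OF subspace_TM] by (metis g_add_left g_sym)

lemma g_scale_right:
  assumes "p \<in> topspace (topol M)" "u \<in> TM p" "v \<in> TM p"
  shows "g p u (r *\<^sub>R v) = r * g p u v"
  using assms subspace_scale[OF subspace_TM] by (metis g_scale_left g_sym)

lemma g_zero_left: "p \<in> topspace (topol M) \<Longrightarrow> v \<in> TM p \<Longrightarrow> g p 0 v = 0"
  using g_scale_left[of p 0 v 0] subspace_0[OF subspace_TM] by simp

lemma g_zero_right: "p \<in> topspace (topol M) \<Longrightarrow> v \<in> TM p \<Longrightarrow> g p v 0 = 0"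
  using g_scale_right[of p v 0 0] subspace_0[OF subspace_TM] by simp

lemma g_diff_left:
  assumes "p \<in> topspace (topol M)" "u \<in> TM p" "v \<in> TM p" "w \<in> TM p"
  shows "g p (u - v) w = g p u w - g p v w"
  using g_add_left[of p "u - v" v w] subspace_diff[OF subspace_TM] assms by simp

lemma g_minus_left:
  assumes "p \<in> topspace (topol M)" "u \<in> TM p" "v \<in> TM p"
  shows "g p (- u) v = - g p u v"
  using g_scale_left[OF assms, of "-1"] by simp

lemma g_sum_left:
  assumes "p \<in> topspace (topol M)" "v \<in> TM p" "\<And>i. i \<in> A \<Longrightarrow> f i \<in> TM p"
  shows "g p (\<Sum>i\<in>A. f i) v = (\<Sum>i\<in>A. g p (f i) v)"
  using assms(3)
  by (induction A rule: infinite_finite_induct)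
    (auto simp: g_zero_left g_add_left subspace_sum[OF subspace_TM] assms(1,2))

lemma g_sum_right:
  assumes "p \<in> topspace (topol M)" "v \<in> TM p" "\<And>i. i \<in> A \<Longrightarrow> f i \<in> TM p"
  shows "g p v (\<Sum>i\<in>A. f i) = (\<Sum>i\<in>A. g p v (f i))"
  using assms(3)
  by (induction A rule: infinite_finite_induct)
    (auto simp: g_zero_right g_add_right subspace_sum[OF subspace_TM] assms(1,2))

lemma g_eq_0_imp: "p \<in> topspace (topol M) \<Longrightarrow> u \<in> TM p \<Longrightarrow> g p u u = 0 \<Longrightarrow> u = 0"
  using g_pos[of p u u] by force

section \<open>Smooth vector fields and smooth functions over open sets\<close>

lemma VF_TM: "X \<in> VF U \<Longrightarrow> p \<in> U \<Longrightarrow> X p \<in> TM p"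
  by (simp add: vector_fields_def)

lemma chart_inv_in: "c \<in> atlas M \<Longrightarrow> x \<in> snd c ` (fst c \<inter> U) \<Longrightarrow> chart_inv c x \<in> U"
  by auto

lemma VF_smooth: "X \<in> VF U \<Longrightarrow> c \<in> atlas M \<Longrightarrow> smooth_on (snd c ` (fst c \<inter> U)) (\<lambda>x. X (chart_inv c x) c)"
  by (simp add: vector_fields_def)

lemma VF_I:
  assumes "\<And>p. p \<in> U \<Longrightarrow> X p \<in> TM p"
    and "\<And>c. c \<in> atlas M \<Longrightarrow> smooth_on (snd c ` (fst c \<inter> U)) (\<lambda>x. X (chart_inv c x) c)"
  shows "X \<in> VF U"
  using assms by (simp add: vector_fields_def)

lemma smooth_fun_smooth:
  "smooth_fun M U f \<Longrightarrow> c \<in> atlas M \<Longrightarrow> smooth_on (snd c ` (fst c \<inter> U)) (\<lambda>x. f (chart_inv c x))"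
  by (simp add: smooth_fun_def)

lemma VF_cong:
  assumes "opn U" "X \<in> VF U" "\<And>p. p \<in> U \<Longrightarrow> X p = Y p"
  shows "Y \<in> VF U"
proof (rule VF_I)
  show "Y p \<in> TM p" if "p \<in> U" for p
    using VF_TM[OF assms(2) that] assms(3)[OF that] by simp
  show "smooth_on (snd c ` (fst c \<inter> U)) (\<lambda>x. Y (chart_inv c x) c)" if c: "c \<in> atlas M" for c
    by (rule smooth_on_cong[OF chart_image_open[OF c assms(1)] _ VF_smooth[OF assms(2) c]])
      (use assms(3) chart_inv_in[OF c] in simp)
qed

lemma VF_subset:
  assumes "opn U" "opn V" "V \<subseteq> U" "X \<in> VF U"
  shows "X \<in> VF V"
proof (rule VF_I)
  show "X p \<in> TM p" if "p \<in> V" for p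
    using VF_TM[OF assms(4)] assms(3) that by blast
  show "smooth_on (snd c ` (fst c \<inter> V)) (\<lambda>x. X (chart_inv c x) c)" if c: "c \<in> atlas M" for c
    by (rule smooth_on_subset[OF VF_smooth[OF assms(4) c] chart_image_open[OF c assms(1)]
          chart_image_open[OF c assms(2)]]) (use assms(3) in blast)
qed

lemma VF_add:
  assumes "opn U" "X \<in> VF U" "Y \<in> VF U"
  shows "X + Y \<in> VF U"
proof (rule VF_I)
  show "(X + Y) p \<in> TM p" if "p \<in> U" for p
    using subspace_add[OF subspace_TM VF_TM[OF assms(2) that] VF_TM[OF assms(3) that]] by simp
  show "smooth_on (snd c ` (fst c \<inter> U)) (\<lambda>x. (X + Y) (chart_inv c x) c)" if c: "c \<in> atlas M" for c
    using smooth_on_add[OF chart_image_open[OF c assms(1)] VF_smooth[OF assms(2) c] VF_smooth[OF assms(3) c]]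
    by simp
qed

lemma VF_scale:
  assumes "opn U" "smooth_fun M U f" "X \<in> VF U"
  shows "(\<lambda>p. f p *\<^sub>R X p) \<in> VF U"
proof (rule VF_I)
  show "f p *\<^sub>R X p \<in> TM p" if "p \<in> U" for p
    using subspace_scale[OF subspace_TM VF_TM[OF assms(3) that]] .
  show "smooth_on (snd c ` (fst c \<inter> U)) (\<lambda>x. (f (chart_inv c x) *\<^sub>R X (chart_inv c x)) c)"
    if c: "c \<in> atlas M" for c
    using smooth_on_scaleR[OF chart_image_open[OF c assms(1)] smooth_fun_smooth[OF assms(2) c]
        VF_smooth[OF assms(3) c]] by simp
qed

lemma VF_zero: "0 \<in> VF U"
  by (rule VF_I) (simp_all add: smooth_on_const subspace_0[OF subspace_TM])

lemma VF_sum: "opn U \<Longrightarrow> (\<And>i. i \<in> A \<Longrightarrow> X i \<in> VF U) \<Longrightarrow> (\<Sum>i\<in>A. X i) \<in> VF U"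
  by (induction A rule: infinite_finite_induct) (auto simp: VF_zero VF_add)

lemma smooth_fun_const: "smooth_fun M U (\<lambda>p. r)"
  by (simp add: smooth_fun_def smooth_on_const)

lemma smooth_fun_cong:
  assumes "opn U" "smooth_fun M U f" "\<And>p. p \<in> U \<Longrightarrow> f p = h p"
  shows "smooth_fun M U h"
  unfolding smooth_fun_def
proof
  fix c assume c: "c \<in> atlas M"
  show "smooth_on (snd c ` (fst c \<inter> U)) (\<lambda>x. h (chart_inv c x))"
    by (rule smooth_on_cong[OF chart_image_open[OF c assms(1)] _ smooth_fun_smooth[OF assms(2) c]])
      (use assms(3) chart_inv_in[OF c] in simp)
qed

lemma smooth_fun_powr:
  assumes "opn U" "smooth_fun M U f" "\<And>p. p \<in> U \<Longrightarrow> f p > 0"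
  shows "smooth_fun M U (\<lambda>p. f p powr a)"
  unfolding smooth_fun_def
proof
  fix c assume c: "c \<in> atlas M"
  show "smooth_on (snd c ` (fst c \<inter> U)) (\<lambda>x. f (chart_inv c x) powr a)"
    by (rule smooth_on_powr[OF chart_image_open[OF c assms(1)] smooth_fun_smooth[OF assms(2) c]])
      (use assms(3) chart_inv_in[OF c] in simp)
qed

lemma smooth_fun_g: "opn U \<Longrightarrow> X \<in> VF U \<Longrightarrow> Y \<in> VF U \<Longrightarrow> smooth_fun M U (\<lambda>p. g p (X p) (Y p))"
  using riem[unfolded riemannian_manifold_def, THEN conjunct2, THEN conjunct2, rule_format, of U X Y]
  by simp

lemma VF_scale_const: "opn U \<Longrightarrow> X \<in> VF U \<Longrightarrow> (\<lambda>p. r *\<^sub>R X p) \<in> VF U"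
  using VF_scale[OF _ smooth_fun_const] .

lemma VF_diff:
  assumes "opn U" "X \<in> VF U" "Y \<in> VF U"
  shows "X - Y \<in> VF U"
  using VF_cong[OF assms(1) VF_add[OF assms(1,2) VF_scale_const[OF assms(1,3), of "-1"]], of "X - Y"]
  by simp

text \<open>Both sides read the derivative in the same chosen chart.
  \<open>frechet_derivative\<close> is a choice among the maps satisfying
  \<open>has_derivative\<close>, and these maps are the same for two functions that agree near the
  point, differentiable or not.\<close>

lemma dir_deriv_cong:
  assumes "opn U" "p \<in> U" "\<And>q. q \<in> U \<Longrightarrow> f q = h q"
  shows "dir_deriv M p v f = dir_deriv M p v h"
proof -
  define c where "c = (SOME c. c \<in> charts_at M p)"
  have "c \<in> charts_at M p"
    using someI_ex[OF charts_at_nonempty[OF open_topspace[OF assms(1,2)]]] by (simp add: c_def)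
  then have c: "c \<in> atlas M" "p \<in> fst c" by (auto dest: charts_atD)
  have o: "open (snd c ` (fst c \<inter> U))" "snd c p \<in> snd c ` (fst c \<inter> U)"
    using chart_image_open[OF c(1) assms(1)] c(2) assms(2) by auto
  have e: "f (chart_inv c x) = h (chart_inv c x)" if "x \<in> snd c ` (fst c \<inter> U)" for x
    using assms(3) chart_inv_in[OF c(1) that] by blast
  have "((\<lambda>x. f (chart_inv c x)) has_derivative D) (at (snd c p)) \<longleftrightarrow>
        ((\<lambda>x. h (chart_inv c x)) has_derivative D) (at (snd c p))" for D
    by (intro iffI; erule has_derivative_transform_within_open[OF _ o]) (simp_all add: e)
  then show ?thesis
    unfolding dir_deriv_def c_def[symmetric] Let_def frechet_derivative_def by simp
qed

lemma dir_deriv_const: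
  assumes "opn U" "p \<in> U" "\<And>q. q \<in> U \<Longrightarrow> f q = r"
  shows "dir_deriv M p v f = 0"
  using dir_deriv_cong[OF assms] by (simp add: dir_deriv_def)

section \<open>Local calculus of the Levi-Civita connection\<close>

lemma nabla_VF: "opn U \<Longrightarrow> X \<in> VF U \<Longrightarrow> Y \<in> VF U \<Longrightarrow> nabla X Y \<in> VF U"
  using lc[unfolded levi_civita_connection_def affine_connection_def, THEN conjunct1, rule_format, of U X Y]
  by simp

context
  fixes U assumes U: "opn U"
begin

lemma nabla_axioms:
  assumes "X \<in> VF U" "Y \<in> VF U" "p \<in> U"
  shows nabla_add_left: "Z \<in> VF U \<Longrightarrow> nabla (X + Z) Y p = nabla X Y p + nabla Z Y p"
    and nabla_add_right: "Z \<in> VF U \<Longrightarrow> nabla X (Y + Z) p = nabla X Y p + nabla X Z p"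
    and nabla_scale_left: "smooth_fun M U f \<Longrightarrow> nabla (\<lambda>q. f q *\<^sub>R X q) Y p = f p *\<^sub>R nabla X Y p"
    and nabla_scale_right: "smooth_fun M U f \<Longrightarrow> nabla X (\<lambda>q. f q *\<^sub>R Y q) p =
      dir_deriv M p (X p) f *\<^sub>R Y p + f p *\<^sub>R nabla X Y p"
    and nabla_torsion: "nabla X Y p - nabla Y X p = lie_bracket M X Y p"
    and nabla_metric: "Z \<in> VF U \<Longrightarrow> dir_deriv M p (X p) (\<lambda>q. g q (Y q) (Z q)) =
      g p (nabla X Y p) (Z p) + g p (Y p) (nabla X Z p)"
  using lc[unfolded levi_civita_connection_def affine_connection_def, THEN conjunct1, rule_format, of U X Y]
    lc[unfolded levi_civita_connection_def, THEN conjunct2, rule_format, of U X Y p] U assms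
  by simp_all

lemma nabla_scale_const_right:
  assumes "X \<in> VF U" "Y \<in> VF U" "p \<in> U"
  shows "nabla X (\<lambda>q. r *\<^sub>R Y q) p = r *\<^sub>R nabla X Y p"
  using nabla_scale_right[OF assms smooth_fun_const, of r] dir_deriv_const[OF U assms(3), of "\<lambda>q. r" r]
  by simp

text \<open>Locality comes from the Leibniz rule: a field vanishing on \<open>U\<close> is unchanged when multiplied by
  the function that is 0 on \<open>U\<close> and 1 elsewhere.\<close>

lemma nabla_cong:
  assumes "X \<in> VF U" "Y \<in> VF U" "p \<in> U"
    and X: "\<And>q. q \<in> U \<Longrightarrow> X q = X' q" and Y: "\<And>q. q \<in> U \<Longrightarrow> Y q = Y' q"
  shows "nabla X Y p = nabla X' Y' p"
proof -
  have VF': "X' \<in> VF U" "Y' \<in> VF U"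
    using VF_cong[OF U assms(1) X] VF_cong[OF U assms(2) Y] by simp_all
  define f :: "'a \<Rightarrow> real" where "f = (\<lambda>q. if q \<in> U then 0 else 1)"
  have f: "smooth_fun M U f"
    by (rule smooth_fun_cong[OF U smooth_fun_const[of U 0]]) (simp add: f_def)
  define Z where "Z = X' - X"
  have Z: "Z \<in> VF U" "Z = (\<lambda>q. f q *\<^sub>R Z q)" "X' = X + Z"
    using VF_diff[OF U VF'(1) assms(1)] X by (auto simp: Z_def f_def fun_eq_iff)
  have "nabla Z Y p = f p *\<^sub>R nabla Z Y p"
    using nabla_scale_left[OF Z(1) assms(2,3) f] unfolding Z(2)[symmetric] .
  then have "nabla Z Y p = 0" using assms(3) by (simp add: f_def)
  then have 1: "nabla X' Y p = nabla X Y p"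
    using nabla_add_left[OF assms(1,2,3) Z(1)] Z(3) by simp
  define W where "W = Y' - Y"
  have W: "W \<in> VF U" "W = (\<lambda>q. f q *\<^sub>R W q)" "Y' = Y + W"
    using VF_diff[OF U VF'(2) assms(2)] Y by (auto simp: W_def f_def fun_eq_iff)
  have "dir_deriv M p (X' p) f = 0"
    using dir_deriv_const[OF U assms(3), of f 0] by (simp add: f_def)
  then have "nabla X' W p = f p *\<^sub>R nabla X' W p"
    using nabla_scale_right[OF VF'(1) W(1) assms(3) f] unfolding W(2)[symmetric] by simp
  then have "nabla X' W p = 0" using assms(3) by (simp add: f_def)
  then have "nabla X' Y' p = nabla X' Y p"
    using nabla_add_right[OF VF'(1) assms(2,3) W(1)] W(3) by simp
  then show ?thesis using 1 by simp
qed

lemma nabla_zero_left: "Y \<in> VF U \<Longrightarrow> p \<in> U \<Longrightarrow> nabla 0 Y p = 0"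
  using nabla_add_left[OF VF_zero _ _ VF_zero, of Y p] by simp

lemma nabla_zero_right: "X \<in> VF U \<Longrightarrow> p \<in> U \<Longrightarrow> nabla X 0 p = 0"
  using nabla_add_right[OF _ VF_zero _ VF_zero, of X p] by simp

lemma nabla_sum_left:
  assumes "\<And>i. i \<in> A \<Longrightarrow> X i \<in> VF U" "Y \<in> VF U" "p \<in> U"
  shows "nabla (\<Sum>i\<in>A. X i) Y p = (\<Sum>i\<in>A. nabla (X i) Y p)"
  using assms(1)
  by (induction A rule: infinite_finite_induct)
    (auto simp: nabla_zero_left nabla_add_left VF_sum U assms(2,3))

lemma nabla_sum_right:
  assumes "\<And>i. i \<in> A \<Longrightarrow> Y i \<in> VF U" "X \<in> VF U" "p \<in> U"
  shows "nabla X (\<Sum>i\<in>A. Y i) p = (\<Sum>i\<in>A. nabla X (Y i) p)"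
  using assms(1)
  by (induction A rule: infinite_finite_induct)
    (auto simp: nabla_zero_right nabla_add_right VF_sum U assms(2,3))

text \<open>Metric compatibility, with the derivative of a constant being 0. It moves a derivative
  from one field to another whenever their inner product is constant, as for two frame fields or for
  two orthogonal fields.\<close>

lemma nabla_metric_const:
  assumes "X \<in> VF U" "Y \<in> VF U" "Z \<in> VF U" "p \<in> U" "\<And>q. q \<in> U \<Longrightarrow> g q (Y q) (Z q) = r"
  shows "g p (nabla X Y p) (Z p) = - g p (Y p) (nabla X Z p)"
  using nabla_metric[OF assms(1,2,4,3)] dir_deriv_const[OF U assms(4), of "\<lambda>q. g q (Y q) (Z q)" r] assms(5)
  by simp

text \<open>The identity of \<open>nabla_metric_const\<close> for \<open>Y\<close>,
  \<open>Z\<close>, \<open>W\<close> holds at all points of \<open>U\<close>, so both of its sides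
  can be differentiated once more along \<open>X\<close>.\<close>

lemma nabla_nabla_metric_const:
  assumes "X \<in> VF U" "Y \<in> VF U" "Z \<in> VF U" "W \<in> VF U" "p \<in> U"
    and const: "\<And>q. q \<in> U \<Longrightarrow> g q (Z q) (W q) = r"
  shows "g p (nabla X (nabla Y Z) p) (W p) + g p (nabla Y Z p) (nabla X W p)
       + g p (nabla X Z p) (nabla Y W p) + g p (Z p) (nabla X (nabla Y W) p) = 0"
proof -
  note N = nabla_VF[OF U assms(2,3)] nabla_VF[OF U assms(2,4)]
  \<comment> \<open>The minus sign is moved into a vector field, so that both sides of the identity
    are inner products of fields and the metric rule applies to each.\<close>
  define nZ where "nZ = (\<lambda>q. (-1) *\<^sub>R Z q)"
  have nZ: "nZ \<in> VF U" unfolding nZ_def by (rule VF_scale_const[OF U assms(3)])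
  have t: "p \<in> topspace (topol M)" if "p \<in> U" for p using that U open_topspace by blast
  have eq: "g q (nabla Y Z q) (W q) = g q (nZ q) (nabla Y W q)" if "q \<in> U" for q
    using nabla_metric_const[OF assms(2,3,4) that const] that t[OF that]
    by (simp add: nZ_def g_minus_left VF_TM[OF assms(3)] VF_TM[OF N(2)])
  have "g p (nabla X (nabla Y Z) p) (W p) + g p (nabla Y Z p) (nabla X W p)
      = g p (nabla X nZ p) (nabla Y W p) + g p (nZ p) (nabla X (nabla Y W) p)"
    using nabla_metric[OF assms(1) N(1) assms(5,4)] nabla_metric[OF assms(1) nZ assms(5) N(2)]
      dir_deriv_cong[OF U assms(5) eq] by simp
  moreover have "nabla X nZ p = (-1) *\<^sub>R nabla X Z p"
    unfolding nZ_def using nabla_scale_const_right[OF assms(1,3,5)] .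
  ultimately show ?thesis
    using assms(5) t[OF assms(5)] VF_TM[OF assms(3)] VF_TM[OF N(2)] VF_TM[OF nabla_VF[OF U assms(1,3)]]
      VF_TM[OF nabla_VF[OF U assms(1) N(2)]]
    by (simp add: nZ_def g_minus_left)
qed

end

section \<open>Orthonormal frames\<close>

text \<open>The index type is arbitrary because adapted frames are indexed by pairs and the frames
  of \<open>frame_at\<close> by natural numbers. Membership of \<open>q\<close> in the space is
  included since the laws of the metric hold only there.\<close>

definition orthonormal_at :: "'a \<Rightarrow> 'i set \<Rightarrow> ('i \<Rightarrow> ('a, 'n) tvec) \<Rightarrow> bool" where
  "orthonormal_at q A e \<longleftrightarrow> q \<in> topspace (topol M) \<and> finite A \<and> (\<forall>a\<in>A. e a \<in> TM q) \<and>
     (\<forall>a\<in>A. \<forall>b\<in>A. g q (e a) (e b) = (if a = b then 1 else 0))"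

lemma orthonormal_atD:
  assumes "orthonormal_at q A e"
  shows "q \<in> topspace (topol M)" "finite A" "\<And>a. a \<in> A \<Longrightarrow> e a \<in> TM q"
    "\<And>a b. a \<in> A \<Longrightarrow> b \<in> A \<Longrightarrow> g q (e a) (e b) = (if a = b then 1 else 0)"
  using assms unfolding orthonormal_at_def by simp_all

lemma orthonormal_at_subset: "orthonormal_at q I e \<Longrightarrow> A \<subseteq> I \<Longrightarrow> orthonormal_at q A e"
  unfolding orthonormal_at_def using finite_subset by blast

lemma orthonormal_at_span_TM: "orthonormal_at q A e \<Longrightarrow> span (e ` A) \<subseteq> TM q"
  by (rule span_minimal[OF _ subspace_TM]) (auto dest: orthonormal_atD)

lemma orthonormal_at_coeff:
  assumes "orthonormal_at q I e" "A \<subseteq> I" "b \<in> I"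
  shows "g q (\<Sum>a\<in>A. c a *\<^sub>R e a) (e b) = (if b \<in> A then c b else 0)"
proof -
  note I = orthonormal_atD[OF assms(1)] and fA = finite_subset[OF assms(2) orthonormal_atD(2)[OF assms(1)]]
  have "g q (\<Sum>a\<in>A. c a *\<^sub>R e a) (e b) = (\<Sum>a\<in>A. g q (c a *\<^sub>R e a) (e b))"
    by (rule g_sum_left[OF I(1) I(3)[OF assms(3)]]) (use I(3) assms(2) subspace_scale[OF subspace_TM] in blast)
  also have "\<dots> = (\<Sum>a\<in>A. if a = b then c a else 0)"
  proof (rule sum.cong)
    fix a assume "a \<in> A"
    then have "a \<in> I" using assms(2) by blast
    then show "g q (c a *\<^sub>R e a) (e b) = (if a = b then c a else 0)"
      by (simp add: g_scale_left[OF I(1) I(3) I(3)[OF assms(3)]] I(4) assms(3))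
  qed simp
  also have "\<dots> = (if b \<in> A then c b else 0)" using fA by (simp add: sum.delta)
  finally show ?thesis .
qed

lemma orthonormal_at_inj: "orthonormal_at q A e \<Longrightarrow> inj_on e A"
  by (rule inj_onI) (metis orthonormal_atD(4) zero_neq_one)

lemma orthonormal_at_expand:
  assumes "orthonormal_at q A e" "v \<in> span (e ` A)"
  shows "v = (\<Sum>a\<in>A. g q v (e a) *\<^sub>R e a)"
proof -
  note inj = orthonormal_at_inj[OF assms(1)]
  have fin: "finite (e ` A)" using orthonormal_atD(2)[OF assms(1)] by simp
  obtain u where "v = (\<Sum>x\<in>e ` A. u x *\<^sub>R x)"
    using assms(2) unfolding span_finite[OF fin] by blast
  then have v: "v = (\<Sum>a\<in>A. u (e a) *\<^sub>R e a)"
    by (simp add: sum.reindex[OF inj])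
  then have "g q v (e b) = u (e b)" if "b \<in> A" for b
    using orthonormal_at_coeff[OF assms(1) order_refl that, of "\<lambda>a. u (e a)"] that by simp
  then show ?thesis using v by (metis (mono_tags, lifting) sum.cong)
qed

lemma orthonormal_at_independent:
  assumes "orthonormal_at q A e"
  shows "independent (e ` A)"
proof (rule independent_if_scalars_zero)
  show "finite (e ` A)" using orthonormal_atD(2)[OF assms] by simp
  fix f x assume "(\<Sum>x\<in>e ` A. f x *\<^sub>R x) = 0" "x \<in> e ` A"
  then obtain b where b: "b \<in> A" "x = e b" and s: "(\<Sum>a\<in>A. f (e a) *\<^sub>R e a) = 0"
    by (auto simp: sum.reindex[OF orthonormal_at_inj[OF assms]])
  show "f x = 0"
    using orthonormal_at_coeff[OF assms order_refl b(1), of "\<lambda>a. f (e a)"] b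
    by (simp add: s g_zero_left[OF orthonormal_atD(1,3)[OF assms]])
qed

lemma orthonormal_at_dim:
  assumes "orthonormal_at q A e"
  shows "dim (span (e ` A)) = card A"
  using dim_span_eq_card_independent[OF orthonormal_at_independent[OF assms]]
    card_image[OF orthonormal_at_inj[OF assms]] by simp

text \<open>A tangent vector outside the span would extend the family to an independent set with
  more than \<open>CARD('n)\<close> elements, against \<open>TM_independent_card\<close>.\<close>

lemma orthonormal_at_full:
  assumes "orthonormal_at q I e" "card I = CARD('n)"
  shows "span (e ` I) = TM q"
proof (rule antisym[OF orthonormal_at_span_TM[OF assms(1)] subsetI], rule ccontr)
  fix v assume v: "v \<in> TM q" "v \<notin> span (e ` I)"
  have "independent (insert v (e ` I))"
    using independent_insertI[OF v(2) orthonormal_at_independent[OF assms(1)]] .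
  moreover have "insert v (e ` I) \<subseteq> TM q" using v orthonormal_atD(3)[OF assms(1)] by blast
  ultimately have "card (insert v (e ` I)) \<le> CARD('n)"
    using TM_independent_card[OF orthonormal_atD(1)[OF assms(1)]] by blast
  moreover have "v \<notin> e ` I" using v(2) span_base[of v "e ` I"] by blast
  ultimately show False
    using orthonormal_atD(2)[OF assms(1)] card_image[OF orthonormal_at_inj[OF assms(1)]] assms(2) by simp
qed

text \<open>The sum over \<open>I - A\<close> is orthogonal to \<open>D q\<close>, and the rest of
  the expansion of \<open>v\<close> lies in \<open>D q\<close>, so it is a candidate for the
  \<open>THE\<close> in \<open>perp_proj\<close>. Two candidates differ by a vector that is both in
  \<open>D q\<close> and orthogonal to \<open>D q\<close>, hence 0.\<close>

lemma perp_proj_eq: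
  assumes o: "orthonormal_at q I e" and full: "span (e ` I) = TM q"
    and A: "A \<subseteq> I" "D q = span (e ` A)" and v: "v \<in> TM q"
  shows "perp_proj M D q v = (\<Sum>z\<in>I-A. g q v (e z) *\<^sub>R e z)"
proof -
  note I = orthonormal_atD[OF o]
  define w where "w = (\<Sum>z\<in>I-A. g q v (e z) *\<^sub>R e z)"
  define d where "d = (\<Sum>z\<in>A. g q v (e z) *\<^sub>R e z)"
  have wT: "w \<in> TM q"
    unfolding w_def by (rule subspace_sum[OF subspace_TM]) (simp add: I(3) subspace_scale[OF subspace_TM])
  have DT: "u \<in> TM q" if "u \<in> D q" for u
    using that A(2) orthonormal_at_span_TM[OF orthonormal_at_subset[OF o A(1)]] by blast
  have we: "g q w (e a) = 0" if "a \<in> A" for a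
    using orthonormal_at_coeff[OF o, of "I - A" a] that A(1) unfolding w_def by auto
  have perp: "g q w u = 0" if "u \<in> D q" for u
  proof -
    have "u = (\<Sum>a\<in>A. g q u (e a) *\<^sub>R e a)"
      using orthonormal_at_expand[OF orthonormal_at_subset[OF o A(1)]] that A(2) by blast
    then have "g q w u = g q w (\<Sum>a\<in>A. g q u (e a) *\<^sub>R e a)" by (rule arg_cong)
    also have "\<dots> = (\<Sum>a\<in>A. g q w (g q u (e a) *\<^sub>R e a))"
      by (rule g_sum_right[OF I(1) wT]) (use I(3) A(1) in \<open>auto intro: subspace_scale[OF subspace_TM]\<close>)
    also have "\<dots> = 0"
      using we A(1) by (intro sum.neutral ballI) (simp add: g_scale_right[OF I(1) wT I(3)] subsetD)
    finally show ?thesis .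
  qed
  have "v = (\<Sum>z\<in>I. g q v (e z) *\<^sub>R e z)"
    using orthonormal_at_expand[OF o] v full by blast
  also have "\<dots> = w + d"
    unfolding w_def d_def by (rule sum.subset_diff[OF A(1) I(2)])
  finally have "v - w = d" by (metis add_diff_cancel_left')
  then have D: "v - w \<in> D q"
    unfolding A(2) d_def by (simp add: span_sum span_scale span_base)
  have uniq: "w' = w" if w': "w' \<in> TM q" "\<forall>u\<in>D q. g q w' u = 0" "v - w' \<in> D q" for w'
  proof -
    have "(v - w) - (v - w') \<in> D q" using D w'(3) unfolding A(2) by (rule span_diff)
    then have d: "w' - w \<in> D q" by (simp add: algebra_simps)
    then have "g q (w' - w) (w' - w) = 0"
      using g_diff_left[OF I(1) w'(1) wT DT[OF d]] w'(2) perp by simp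
    then show ?thesis using g_eq_0_imp[OF I(1) DT[OF d]] by simp
  qed
  show ?thesis
    unfolding perp_proj_def w_def[symmetric]
  proof (rule the_equality)
    show "w \<in> TM q \<and> (\<forall>u\<in>D q. g q w u = 0) \<and> v - w \<in> D q" using wT perp D by blast
    show "w' = w" if "w' \<in> TM q \<and> (\<forall>u\<in>D q. g q w' u = 0) \<and> v - w' \<in> D q" for w'
      by (rule uniq) (use that in blast)+
  qed
qed

text \<open>The counterpart of \<open>orthonormal_frame\<close> for any index set, bundled with
  openness of \<open>U\<close>; index sets \<open>{..<m}\<close> give the original notion
  back.\<close>

definition frame_on :: "('a, 'n) distr \<Rightarrow> 'a set \<Rightarrow> 'i set \<Rightarrow> ('i \<Rightarrow> ('a, 'n) vfield) \<Rightarrow> bool" where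
  "frame_on D U A E \<longleftrightarrow> opn U \<and> (\<forall>a\<in>A. E a \<in> VF U) \<and>
     (\<forall>q\<in>U. orthonormal_at q A (\<lambda>a. E a q) \<and> span ((\<lambda>a. E a q) ` A) = D q)"

lemma frame_onD:
  assumes "frame_on D U A E"
  shows "opn U" "\<And>a. a \<in> A \<Longrightarrow> E a \<in> VF U" "\<And>q. q \<in> U \<Longrightarrow> orthonormal_at q A (\<lambda>a. E a q)"
    "\<And>q. q \<in> U \<Longrightarrow> span ((\<lambda>a. E a q) ` A) = D q"
  using assms unfolding frame_on_def by simp_all

lemma frame_on_orthonormal_frame:
  "frame_on D U {..<m} E \<longleftrightarrow> opn U \<and> orthonormal_frame M D U m E"
proof -
  have "orthonormal_at q {..<m} (\<lambda>a. E a q) \<longleftrightarrow>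
      (\<forall>a<m. \<forall>b<m. g q (E a q) (E b q) = (if a = b then 1 else 0))"
    if "opn U" "q \<in> U" "\<forall>a<m. E a \<in> VF U" for q
    unfolding orthonormal_at_def Ball_def lessThan_iff
    using that open_topspace[OF that(1,2)] VF_TM[OF _ that(2)] by simp
  then show ?thesis
    unfolding frame_on_def orthonormal_frame_def Ball_def lessThan_iff by blast
qed

lemma frame_on_subset:
  assumes "frame_on D U A E" "opn V" "V \<subseteq> U"
  shows "frame_on D V A E"
  unfolding frame_on_def
proof (intro conjI ballI)
  show "E a \<in> VF V" if "a \<in> A" for a
    by (rule VF_subset[OF frame_onD(1)[OF assms(1)] assms(2,3) frame_onD(2)[OF assms(1) that]])
qed (use assms(2,3) frame_onD(3,4)[OF assms(1)] in auto)

lemma frame_on_dim: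
  "frame_on D U A E \<Longrightarrow> q \<in> U \<Longrightarrow> dim (D q) = card A"
  using orthonormal_at_dim frame_onD(3,4) by metis

lemma frame_on_reindex:
  assumes "frame_on D U A E" "bij_betw h B A"
  shows "frame_on D U B (\<lambda>b. E (h b))"
proof -
  have h: "h b \<in> A" if "b \<in> B" for b using assms(2) that by (auto simp: bij_betw_def)
  have inj: "h a = h b \<longleftrightarrow> a = b" if "a \<in> B" "b \<in> B" for a b
    using assms(2) that by (auto simp: bij_betw_def inj_on_def)
  have "orthonormal_at q B (\<lambda>b. E (h b) q)" if "q \<in> U" for q
    using orthonormal_atD[OF frame_onD(3)[OF assms(1) that]] h bij_betw_finite[OF assms(2)]
    unfolding orthonormal_at_def by (simp add: inj)
  moreover have "(\<lambda>b. E (h b) q) ` B = (\<lambda>a. E a q) ` A" for q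
    using assms(2) by (auto simp: bij_betw_def)
  ultimately show ?thesis
    using frame_onD[OF assms(1)] h unfolding frame_on_def by simp
qed

text \<open>A given frame, renumbered by natural numbers, witnesses the existence statement behind
  the \<open>SOME\<close> in \<open>frame_at\<close>. The chosen frame brings its own neighbourhood
  \<open>V\<close>, which is unrelated to \<open>U\<close>.\<close>

lemma frame_at_frame_on:
  assumes "frame_on D U A E" "p \<in> U"
  obtains V where "p \<in> V" "frame_on D V {..<card A} (frame_at M D p)"
proof -
  have "finite A" using orthonormal_atD(2)[OF frame_onD(3)[OF assms]] .
  then obtain h where "bij_betw h {..<card A} A"
    using ex_bij_betw_nat_finite[of A] by (auto simp: atLeast0LessThan)
  then have "frame_on D U {..<dim (D p)} (\<lambda>b. E (h b))"
    using frame_on_reindex[OF assms(1)] frame_on_dim[OF assms] by simp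
  then have "\<exists>F U. opn U \<and> p \<in> U \<and> orthonormal_frame M D U (dim (D p)) F"
    using assms(2) unfolding frame_on_orthonormal_frame by blast
  then have "\<exists>U. opn U \<and> p \<in> U \<and> orthonormal_frame M D U (dim (D p)) (frame_at M D p)"
    unfolding frame_at_def by (rule someI_ex)
  then show ?thesis
    using that frame_on_dim[OF assms] unfolding frame_on_orthonormal_frame by metis
qed

text \<open>The Gram-Schmidt process with smooth coefficients. By the dimension premise the
  \<open>m\<close> fields are independent at every point of \<open>U\<close>, so no residual
  vanishes anywhere and the same \<open>U\<close> serves for every step.\<close>

lemma gram_schmidt:
  assumes U: "opn U" and E: "\<And>a. a < m \<Longrightarrow> E a \<in> VF U"
    and dim: "\<And>q. q \<in> U \<Longrightarrow> dim (span ((\<lambda>a. E a q) ` {..<m})) = m"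
    and "j \<le> m"
  shows "\<exists>F. frame_on (\<lambda>q. span ((\<lambda>a. E a q) ` {..<j})) U {..<j} F"
  using \<open>j \<le> m\<close>
proof (induction j)
  case 0
  have "frame_on (\<lambda>q. span ((\<lambda>a. E a q) ` {..<0::nat})) U {..<0::nat} E"
    using U open_topspace unfolding frame_on_def orthonormal_at_def by auto
  then show ?case by blast
next
  case (Suc j)
  then obtain F where F: "frame_on (\<lambda>q. span ((\<lambda>a. E a q) ` {..<j})) U {..<j} F" by auto
  have jm: "j < m" using Suc.prems by simp
  note FD = frame_onD[OF F]
  define P where "P = (\<Sum>a<j. (\<lambda>q. g q (E j q) (F a q) *\<^sub>R F a q))"
  define W where "W = E j - P"
  have P_apply: "P q = (\<Sum>a<j. g q (E j q) (F a q) *\<^sub>R F a q)" for q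
    unfolding P_def by (simp add: sum_fun_apply)
  have P: "P \<in> VF U"
    unfolding P_def
    by (intro VF_sum[OF U] VF_scale[OF U] smooth_fun_g[OF U] E FD(2)) (use jm in auto)
  have W: "W \<in> VF U" unfolding W_def by (rule VF_diff[OF U E[OF jm] P])
  have PF: "P q \<in> span ((\<lambda>a. F a q) ` {..<j})" for q
    unfolding P_apply by (intro span_sum span_scale span_base) auto
  \<comment> \<open>If the residual were 0 at \<open>q\<close>, then \<open>E j q\<close> would lie
    in the span of the earlier fields, and the remaining \<open>m - 1\<close> vectors would span a
    space of dimension \<open>m\<close>.\<close>
  have W0: "W q \<noteq> 0" if q: "q \<in> U" for q
  proof
    assume "W q = 0"
    then have "E j q \<in> span ((\<lambda>a. E a q) ` {..<j})"
      using PF[of q] FD(4)[OF q] by (simp add: W_def)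
    also have "\<dots> \<subseteq> span ((\<lambda>a. E a q) ` ({..<m} - {j}))"
      using jm by (intro span_mono) auto
    finally have j: "E j q \<in> span ((\<lambda>a. E a q) ` ({..<m} - {j}))" .
    have "(\<lambda>a. E a q) ` {..<m} \<subseteq> span ((\<lambda>a. E a q) ` ({..<m} - {j}))"
    proof
      fix x assume "x \<in> (\<lambda>a. E a q) ` {..<m}"
      then obtain a where "a < m" "x = E a q" by auto
      then show "x \<in> span ((\<lambda>a. E a q) ` ({..<m} - {j}))"
        using j by (cases "a = j") (auto intro!: span_base)
    qed
    then have "span ((\<lambda>a. E a q) ` {..<m}) \<subseteq> span ((\<lambda>a. E a q) ` ({..<m} - {j}))"
      by (simp add: span_minimal)
    then have "dim (span ((\<lambda>a. E a q) ` {..<m})) \<le> card ((\<lambda>a. E a q) ` ({..<m} - {j}))"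
      by (intro dim_le_card) auto
    also have "\<dots> \<le> card ({..<m} - {j})" by (intro card_image_le) simp
    also have "\<dots> < m" using jm by simp
    finally show False using dim[OF q] by simp
  qed
  define n where "n = (\<lambda>q. g q (W q) (W q))"
  have n0: "n q > 0" if "q \<in> U" for q
    unfolding n_def by (rule g_pos[OF open_topspace[OF U that] VF_TM[OF W that] VF_TM[OF W that] W0[OF that]])
  \<comment> \<open>The reciprocal length of \<open>W\<close>, written as a power so that its
    smoothness follows from \<open>smooth_fun_powr\<close>.\<close>
  define c where "c = (\<lambda>q. n q powr (- 1/2))"
  define G where "G = (\<lambda>q. c q *\<^sub>R W q)"
  have G: "G \<in> VF U"
    unfolding G_def c_def
    by (intro VF_scale[OF U] W smooth_fun_powr[OF U] n0) (simp_all add: n_def smooth_fun_g[OF U W W])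
  define F' where "F' = F(j := G)"
  have GF: "g q (G q) (F a q) = 0" if q: "q \<in> U" and a: "a < j" for q a
  proof -
    note t = open_topspace[OF U q] and Fa = VF_TM[OF FD(2) q, of a]
    have "g q (P q) (F a q) = g q (E j q) (F a q)"
      unfolding P_apply using orthonormal_at_coeff[OF FD(3)[OF q] order_refl, of a] a by simp
    then have "g q (W q) (F a q) = 0"
      using g_diff_left[OF t VF_TM[OF E[OF jm] q] VF_TM[OF P q] Fa] a by (simp add: W_def)
    then show ?thesis
      unfolding G_def using g_scale_left[OF t VF_TM[OF W q] Fa] a by simp
  qed
  have c2: "c q * c q * n q = 1" if "q \<in> U" for q
  proof -
    have "c q * c q = n q powr (- 1)" unfolding c_def by (simp add: powr_add[symmetric])
    then show ?thesis using n0[OF that] by (simp add: powr_minus)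
  qed
  have GG: "g q (G q) (G q) = 1" if q: "q \<in> U" for q
  proof -
    note t = open_topspace[OF U q] and Wq = VF_TM[OF W q] and Gq = VF_TM[OF G q]
    have "g q (G q) (G q) = c q * (c q * n q)"
      using g_scale_left[OF t Wq Gq, of "c q"] g_scale_right[OF t Wq Wq, of "c q"]
      by (simp add: G_def n_def)
    then show ?thesis using c2[OF q] by (simp add: mult.assoc)
  qed
  have o: "orthonormal_at q {..<Suc j} (\<lambda>a. F' a q)" if q: "q \<in> U" for q
  proof -
    note t = open_topspace[OF U q] and Fq = orthonormal_atD[OF FD(3)[OF q]] and Gq = VF_TM[OF G q]
    have "g q (F a q) (G q) = 0" if "a < j" for a
      using GF[OF q that] g_sym[OF t Fq(3) Gq] that by simp
    then show ?thesis
      unfolding orthonormal_at_def F'_def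
      using t Fq Gq GF[OF q] GG[OF q] by (auto simp: less_Suc_eq)
  qed
  \<comment> \<open>\<open>G q\<close> is a nonzero multiple of \<open>E j q - P q\<close>, and
    \<open>P q\<close> lies in the span of the earlier fields. So either of \<open>G q\<close> and
    \<open>E j q\<close> can be recovered from the other together with that span.\<close>
  have sp: "span ((\<lambda>a. F' a q) ` {..<Suc j}) = span ((\<lambda>a. E a q) ` {..<Suc j})" if q: "q \<in> U" for q
  proof -
    let ?F = "(\<lambda>a. F a q) ` {..<j}" and ?E = "(\<lambda>a. E a q) ` {..<j}"
    have im: "(\<lambda>a. F' a q) ` {..<Suc j} = insert (G q) ?F" "(\<lambda>a. E a q) ` {..<Suc j} = insert (E j q) ?E"
      unfolding F'_def by (auto simp: lessThan_Suc)
    have FE: "span ?F = span ?E" using FD(4)[OF q] .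
    have mono: "span ?F \<subseteq> span (insert x ?F)" "span ?E \<subseteq> span (insert x ?E)" for x
      by (auto intro!: span_mono)
    have c0: "c q \<noteq> 0" using c2[OF q] by auto
    have "E j q - P q \<in> span (insert (E j q) ?E)"
      using PF[of q] mono(2) unfolding FE by (intro span_diff) (auto intro: span_base)
    then have "G q \<in> span (insert (E j q) ?E)" unfolding G_def W_def by (simp add: span_scale)
    then have 1: "insert (G q) ?F \<subseteq> span (insert (E j q) ?E)"
      using mono(2) FE span_superset[of ?F] by blast
    have "E j q = (1 / c q) *\<^sub>R G q + P q" using c0 by (simp add: G_def W_def)
    moreover have "(1 / c q) *\<^sub>R G q \<in> span (insert (G q) ?F)" "P q \<in> span (insert (G q) ?F)"
      using PF[of q] mono(1) by (auto intro: span_scale span_base)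
    ultimately have "E j q \<in> span (insert (G q) ?F)" by (metis span_add)
    then have 2: "insert (E j q) ?E \<subseteq> span (insert (G q) ?F)"
      using mono(1) FE span_superset[of ?E] by blast
    show ?thesis unfolding im
      using 1 2 by (intro antisym span_minimal subspace_span)
  qed
  have "frame_on (\<lambda>q. span ((\<lambda>a. E a q) ` {..<Suc j})) U {..<Suc j} F'"
    unfolding frame_on_def using U o sp FD(2) G by (auto simp: F'_def less_Suc_eq)
  then show ?case by blast
qed

text \<open>Gram-Schmidt turns the spanning fields of a distribution into an orthonormal frame, so
  the choice in \<open>frame_at\<close> succeeds.\<close>

lemma distribution_frame_at:
  assumes "distribution M m D" "p \<in> topspace (topol M)"
  obtains V where "p \<in> V" "frame_on D V {..<m} (frame_at M D p)"
proof -
  have dimD: "dim (D q) = m" if "q \<in> topspace (topol M)" for q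
    using assms(1)[unfolded distribution_def, THEN bspec, OF that] by simp
  have "\<exists>U E. opn U \<and> p \<in> U \<and> (\<forall>a<m. E a \<in> VF U) \<and> (\<forall>q\<in>U. span ((\<lambda>a. E a q) ` {..<m}) = D q)"
    using assms(1)[unfolded distribution_def, THEN bspec, OF assms(2)] by simp
  then obtain U E where U: "opn U" "p \<in> U" and E: "\<And>a. a < m \<Longrightarrow> E a \<in> VF U"
    and sp: "\<And>q. q \<in> U \<Longrightarrow> span ((\<lambda>a. E a q) ` {..<m}) = D q"
    by blast
  have "dim (span ((\<lambda>a. E a q) ` {..<m})) = m" if "q \<in> U" for q
    using sp[OF that] dimD[OF open_topspace[OF U(1) that]] by simp
  then obtain F where "frame_on (\<lambda>q. span ((\<lambda>a. E a q) ` {..<m})) U {..<m} F"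
    using gram_schmidt[of U m E m, OF U(1) E _ order_refl] by blast
  then have "frame_on D U {..<m} F" using sp unfolding frame_on_def by simp
  then show ?thesis using frame_at_frame_on[OF _ U(2)] that by force
qed

end

section \<open>Change of frame\<close>

text \<open>Invariance of the trace: the premise says that the columns of \<open>c\<close> are
  orthonormal, and with the sum over \<open>a\<close> innermost only the diagonal terms survive. It
  serves the divergence and the mean curvature.\<close>

lemma trace_orthogonal_change:
  fixes c :: "'b \<Rightarrow> 'i \<Rightarrow> real"
  assumes "finite A" "\<And>s t. s \<in> A \<Longrightarrow> t \<in> A \<Longrightarrow> (\<Sum>a\<in>B. c a s * c a t) = (if s = t then 1 else 0)"
  shows "(\<Sum>a\<in>B. \<Sum>s\<in>A. \<Sum>t\<in>A. c a s * c a t * x s t) = (\<Sum>s\<in>A. x s s)"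
proof -
  have "(\<Sum>a\<in>B. \<Sum>s\<in>A. \<Sum>t\<in>A. c a s * c a t * x s t)
      = (\<Sum>s\<in>A. \<Sum>t\<in>A. \<Sum>a\<in>B. c a s * c a t * x s t)"
    by (subst sum.swap) (intro sum.cong refl sum.swap)
  also have "\<dots> = (\<Sum>s\<in>A. \<Sum>t\<in>A. if s = t then x s t else 0)"
    by (intro sum.cong refl) (simp add: sum_distrib_right[symmetric] assms(2))
  also have "\<dots> = (\<Sum>s\<in>A. x s s)"
    using assms(1) by (intro sum.cong refl) simp
  finally show ?thesis .
qed

text \<open>Invariance of the full contraction of two bilinear forms, by the trace rule applied to
  one index after the other. It serves the norms of \<open>h\<close> and \<open>T\<close>.\<close>

lemma contraction_orthogonal_change:
  fixes c :: "'b \<Rightarrow> 'i \<Rightarrow> real"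
  assumes "finite A" "\<And>s t. s \<in> A \<Longrightarrow> t \<in> A \<Longrightarrow> (\<Sum>a\<in>B. c a s * c a t) = (if s = t then 1 else 0)"
  shows "(\<Sum>a\<in>B. \<Sum>b\<in>B. (\<Sum>s\<in>A. \<Sum>t\<in>A. c a s * c b t * x s t) * (\<Sum>s\<in>A. \<Sum>t\<in>A. c a s * c b t * y s t))
    = (\<Sum>s\<in>A. \<Sum>t\<in>A. x s t * y s t)" (is "?L = _")
proof -
  \<comment> \<open>The form \<open>z\<close> with only its second index transformed; the first
    trace rule is applied with this intermediate form held fixed.\<close>
  define f where "f = (\<lambda>(z :: 'i \<Rightarrow> 'i \<Rightarrow> real) b s. \<Sum>t\<in>A. c b t * z s t)"
  have f: "(\<Sum>s\<in>A. \<Sum>t\<in>A. c a s * c b t * z s t) = (\<Sum>s\<in>A. c a s * f z b s)" for a b z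
    unfolding f_def by (simp add: sum_distrib_left mult.assoc)
  have "?L = (\<Sum>b\<in>B. \<Sum>a\<in>B. (\<Sum>s\<in>A. c a s * f x b s) * (\<Sum>s\<in>A. c a s * f y b s))"
    unfolding f by (rule sum.swap)
  also have "\<dots> = (\<Sum>b\<in>B. \<Sum>a\<in>B. \<Sum>s\<in>A. \<Sum>t\<in>A. c a s * c a t * (f x b s * f y b t))"
    by (simp add: sum_product mult_ac)
  also have "\<dots> = (\<Sum>b\<in>B. \<Sum>s\<in>A. f x b s * f y b s)"
    using trace_orthogonal_change[OF assms] by (intro sum.cong refl) simp
  also have "\<dots> = (\<Sum>s\<in>A. \<Sum>b\<in>B. f x b s * f y b s)" by (rule sum.swap)
  also have "\<dots> = (\<Sum>s\<in>A. \<Sum>b\<in>B. \<Sum>t\<in>A. \<Sum>t'\<in>A. c b t * c b t' * (x s t * y s t'))"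
    unfolding f_def by (simp add: sum_product mult_ac)
  also have "\<dots> = (\<Sum>s\<in>A. \<Sum>t\<in>A. x s t * y s t)"
    using trace_orthogonal_change[OF assms] by (intro sum.cong refl) simp
  finally show ?thesis .
qed

context riemannian_connection
begin

lemma nabla_VF_TM: "opn U \<Longrightarrow> X \<in> VF U \<Longrightarrow> Y \<in> VF U \<Longrightarrow> p \<in> U \<Longrightarrow> nabla X Y p \<in> TM p"
  using VF_TM nabla_VF by blast

text \<open>Parseval for \<open>e s\<close> and \<open>e t\<close> in the family \<open>f\<close>,
  possible since both families have the same span. This is the premise of the two invariance
  rules.\<close>

lemma orthonormal_at_change:
  assumes "orthonormal_at q A e" "orthonormal_at q B f" "span (e ` A) = span (f ` B)"
    and "s \<in> A" "t \<in> A"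
  shows "(\<Sum>a\<in>B. g q (f a) (e s) * g q (f a) (e t)) = (if s = t then 1 else 0)"
proof -
  note A = orthonormal_atD[OF assms(1)] and B = orthonormal_atD[OF assms(2)]
  have "e s \<in> span (f ` B)" using assms(3,4) span_base[of "e s" "e ` A"] by blast
  then have "e s = (\<Sum>a\<in>B. g q (e s) (f a) *\<^sub>R f a)" by (rule orthonormal_at_expand[OF assms(2)])
  then have "g q (e s) (e t) = g q (\<Sum>a\<in>B. g q (e s) (f a) *\<^sub>R f a) (e t)" by (rule arg_cong)
  also have "\<dots> = (\<Sum>a\<in>B. g q (g q (e s) (f a) *\<^sub>R f a) (e t))"
    by (rule g_sum_left[OF A(1) A(3)[OF assms(5)]]) (simp add: B(3) subspace_scale[OF subspace_TM])
  also have "\<dots> = (\<Sum>a\<in>B. g q (f a) (e s) * g q (f a) (e t))"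
    by (rule sum.cong) (simp_all add: g_scale_left[OF A(1) B(3) A(3)[OF assms(5)]] g_sym[OF A(1) B(3) A(3)[OF assms(4)]])
  finally show ?thesis using A(4)[OF assms(4,5)] by simp
qed

section \<open>Expansion of the connection in a frame\<close>

lemma frame_expand:
  assumes "frame_on D U A E" "q \<in> U" "V q \<in> D q"
  shows "(\<Sum>s\<in>A. (\<lambda>q. g q (V q) (E s q) *\<^sub>R E s q)) q = V q"
proof -
  have "V q = (\<Sum>s\<in>A. g q (V q) (E s q) *\<^sub>R E s q)"
    using orthonormal_at_expand[OF frame_onD(3)[OF assms(1,2)]] frame_onD(4)[OF assms(1,2)] assms(3)
    by simp
  then show ?thesis by (simp add: sum_fun_apply)
qed

lemma nabla_expand_left:
  assumes F: "frame_on D U A E" and V: "V \<in> VF U" "\<And>q. q \<in> U \<Longrightarrow> V q \<in> D q"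
    and Y: "Y \<in> VF U" and p: "p \<in> U"
  shows "nabla V Y p = (\<Sum>s\<in>A. g p (V p) (E s p) *\<^sub>R nabla (E s) Y p)"
proof -
  note U = frame_onD(1)[OF F] and E = frame_onD(2)[OF F]
  define W where "W = (\<lambda>s q. g q (V q) (E s q) *\<^sub>R E s q)"
  have W: "W s \<in> VF U" if "s \<in> A" for s
    unfolding W_def by (intro VF_scale[OF U] smooth_fun_g[OF U] V E that)
  \<comment> \<open>The expansion of \<open>V\<close> in the frame is an equality on
    \<open>U\<close> only; locality of the connection carries it into the first argument.\<close>
  have "nabla (\<Sum>s\<in>A. W s) Y p = nabla V Y p"
    unfolding W_def by (rule nabla_cong[OF U _ Y p frame_expand[OF F _ V(2)] refl])
      (use W VF_sum[OF U, of A W] in \<open>simp_all add: W_def\<close>)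
  moreover have "nabla (\<Sum>s\<in>A. W s) Y p = (\<Sum>s\<in>A. nabla (W s) Y p)"
    by (rule nabla_sum_left[OF U W Y p])
  moreover have "nabla (W s) Y p = g p (V p) (E s p) *\<^sub>R nabla (E s) Y p" if "s \<in> A" for s
    unfolding W_def by (rule nabla_scale_left[OF U E[OF that] Y p smooth_fun_g[OF U V(1) E[OF that]]])
  ultimately show ?thesis by simp
qed

lemma nabla_expand_right:
  assumes F: "frame_on D U A E" and V: "V \<in> VF U" "\<And>q. q \<in> U \<Longrightarrow> V q \<in> D q"
    and X: "X \<in> VF U" and p: "p \<in> U"
  shows "nabla X V p = (\<Sum>s\<in>A. dir_deriv M p (X p) (\<lambda>q. g q (V q) (E s q)) *\<^sub>R E s p
    + g p (V p) (E s p) *\<^sub>R nabla X (E s) p)"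
proof -
  note U = frame_onD(1)[OF F] and E = frame_onD(2)[OF F]
  define W where "W = (\<lambda>s q. g q (V q) (E s q) *\<^sub>R E s q)"
  have W: "W s \<in> VF U" if "s \<in> A" for s
    unfolding W_def by (intro VF_scale[OF U] smooth_fun_g[OF U] V E that)
  have "nabla X (\<Sum>s\<in>A. W s) p = nabla X V p"
    unfolding W_def by (rule nabla_cong[OF U X _ p refl frame_expand[OF F _ V(2)]])
      (use W VF_sum[OF U, of A W] in \<open>simp_all add: W_def\<close>)
  moreover have "nabla X (\<Sum>s\<in>A. W s) p = (\<Sum>s\<in>A. nabla X (W s) p)"
    by (rule nabla_sum_right[OF U W X p])
  moreover have "nabla X (W s) p = dir_deriv M p (X p) (\<lambda>q. g q (V q) (E s q)) *\<^sub>R E s p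
      + g p (V p) (E s p) *\<^sub>R nabla X (E s) p" if "s \<in> A" for s
    unfolding W_def by (rule nabla_scale_right[OF U X E[OF that] p smooth_fun_g[OF U V(1) E[OF that]]])
  ultimately show ?thesis by simp
qed

text \<open>The connection coefficients \<omega>. The point is the last argument, so that each
  coefficient is a function on the manifold and can itself be differentiated or used to scale a
  field.\<close>

definition conn :: "('i \<Rightarrow> ('a, 'n) vfield) \<Rightarrow> 'i \<Rightarrow> 'i \<Rightarrow> 'i \<Rightarrow> 'a \<Rightarrow> real" where
  "conn E x y z p = g p (nabla (E x) (E y) p) (E z p)"

context
  fixes U I and E :: "'i \<Rightarrow> ('a, 'n) vfield"
  assumes F: "frame_on TM U I E"
begin

lemmas frame_open = frame_onD(1)[OF F]
lemmas frame_VF = frame_onD(2)[OF F]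
lemmas frame_orthonormal = frame_onD(3)[OF F]
lemmas frame_TM = VF_TM[OF frame_VF]
lemmas frame_finite = orthonormal_atD(2)[OF frame_orthonormal]
lemmas frame_topspace = orthonormal_atD(1)[OF frame_orthonormal]

lemma frame_nabla_TM: "x \<in> I \<Longrightarrow> y \<in> I \<Longrightarrow> p \<in> U \<Longrightarrow> nabla (E x) (E y) p \<in> TM p"
  by (rule nabla_VF_TM[OF frame_open frame_VF frame_VF])

text \<open>Metric compatibility, since inner products of frame fields are constant.\<close>

lemma conn_skew:
  assumes "x \<in> I" "y \<in> I" "z \<in> I" "p \<in> U"
  shows "conn E x z y p = - conn E x y z p"
proof -
  have "g p (nabla (E x) (E y) p) (E z p) = - g p (E y p) (nabla (E x) (E z) p)"
    by (rule nabla_metric_const[OF frame_open, where r = "if y = z then 1 else 0"])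
      (simp_all add: frame_VF assms orthonormal_atD(4)[OF frame_orthonormal])
  then show ?thesis
    unfolding conn_def
    using g_sym[OF frame_topspace[OF assms(4)] frame_TM[OF assms(2,4)] frame_nabla_TM[OF assms(1,3,4)]] by simp
qed

lemma nabla_frame_expand:
  assumes "V \<in> VF U" "Y \<in> VF U" "p \<in> U"
  shows "nabla V Y p = (\<Sum>s\<in>I. g p (V p) (E s p) *\<^sub>R nabla (E s) Y p)"
  by (rule nabla_expand_left[OF F assms(1) VF_TM[OF assms(1)] assms(2,3)])

text \<open>\<open>divergence\<close> is evaluated in the frame chosen by \<open>frame_at\<close>.
  Expanding that frame in \<open>E\<close> gives a double sum over the change-of-frame matrix, which
  the trace rule reduces to the diagonal.\<close>

lemma divergence_frame:
  assumes X: "X \<in> VF U" and p: "p \<in> U"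
  shows "divergence M nabla X p = (\<Sum>s\<in>I. g p (nabla (E s) X p) (E s p))"
proof -
  obtain V where V: "p \<in> V" and G: "frame_on TM V {..<card I} (frame_at M TM p)"
    using frame_at_frame_on[OF F p] by blast
  define G where "G = frame_at M TM p"
  note t = frame_topspace[OF p]
  \<comment> \<open>The two frames live on different neighbourhoods, so everything is restricted to
    the intersection.\<close>
  define W where "W = U \<inter> V"
  have W: "opn W" "W \<subseteq> U" "W \<subseteq> V" "p \<in> W"
    using frame_open frame_onD(1)[OF G] p V by (auto simp: W_def)
  have FW: "frame_on TM W I E" by (rule frame_on_subset[OF F W(1,2)])
  have GW: "frame_on TM W {..<card I} G" unfolding G_def by (rule frame_on_subset[OF G W(1,3)])
  have XW: "X \<in> VF W" by (rule VF_subset[OF frame_open W(1,2) X])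
  note GV = frame_onD(2)[OF GW]
  have nT: "nabla (E s) X p \<in> TM p" if "s \<in> I" for s
    by (rule nabla_VF_TM[OF frame_open frame_VF[OF that] X p])
  have "g p (nabla (G a) X p) (G a p)
      = (\<Sum>s\<in>I. \<Sum>t\<in>I. g p (G a p) (E s p) * g p (G a p) (E t p) * g p (nabla (E s) X p) (E t p))"
    if a: "a < card I" for a
  proof -
    have aI: "a \<in> {..<card I}" using a by simp
    note Ga = VF_TM[OF GV[OF aI] W(4)]
    have 1: "nabla (G a) X p = (\<Sum>s\<in>I. g p (G a p) (E s p) *\<^sub>R nabla (E s) X p)"
      by (rule nabla_expand_left[OF FW GV[OF aI] VF_TM[OF GV[OF aI]] XW W(4)])
    have 2: "G a p = (\<Sum>t\<in>I. g p (G a p) (E t p) *\<^sub>R E t p)"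
      using frame_expand[OF F p, of "G a"] Ga by (simp add: sum_fun_apply)
    have sc: "r *\<^sub>R nabla (E s) X p \<in> TM p" "r *\<^sub>R E s p \<in> TM p" if "s \<in> I" for s r
      using nT[OF that] frame_TM[OF that p] by (auto intro: subspace_scale[OF subspace_TM])
    have inner: "g p (nabla (E s) X p) (G a p) = (\<Sum>t\<in>I. g p (G a p) (E t p) * g p (nabla (E s) X p) (E t p))"
      if "s \<in> I" for s
    proof -
      have "g p (nabla (E s) X p) (G a p) = g p (nabla (E s) X p) (\<Sum>t\<in>I. g p (G a p) (E t p) *\<^sub>R E t p)"
        by (rule arg_cong[OF 2])
      also have "\<dots> = (\<Sum>t\<in>I. g p (nabla (E s) X p) (g p (G a p) (E t p) *\<^sub>R E t p))"
        by (rule g_sum_right[OF t nT[OF that]]) (rule sc)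
      also have "\<dots> = (\<Sum>t\<in>I. g p (G a p) (E t p) * g p (nabla (E s) X p) (E t p))"
        by (rule sum.cong) (simp_all add: g_scale_right[OF t nT[OF that]] frame_TM p)
      finally show ?thesis .
    qed
    have "g p (nabla (G a) X p) (G a p) = (\<Sum>s\<in>I. g p (g p (G a p) (E s p) *\<^sub>R nabla (E s) X p) (G a p))"
      unfolding 1 by (rule g_sum_left[OF t Ga]) (rule sc)
    also have "\<dots> = (\<Sum>s\<in>I. g p (G a p) (E s p) * g p (nabla (E s) X p) (G a p))"
      by (rule sum.cong) (simp_all add: g_scale_left[OF t nT Ga])
    finally show ?thesis by (simp add: inner sum_distrib_left mult.assoc)
  qed
  then have "(\<Sum>a\<in>{..<card I}. g p (nabla (G a) X p) (G a p))
    = (\<Sum>a\<in>{..<card I}. \<Sum>s\<in>I. \<Sum>t\<in>I. g p (G a p) (E s p) * g p (G a p) (E t p) * g p (nabla (E s) X p) (E t p))"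
    by (intro sum.cong) auto
  also have "\<dots> = (\<Sum>s\<in>I. g p (nabla (E s) X p) (E s p))"
    by (rule trace_orthogonal_change[OF frame_finite[OF p]
          orthonormal_at_change[OF frame_orthonormal[OF p] frame_onD(3)[OF GW W(4)]]])
      (simp_all add: frame_onD(4)[OF F p] frame_onD(4)[OF GW W(4)])
  finally show ?thesis
    unfolding divergence_def Let_def G_def[symmetric] frame_on_dim[OF F p] .
qed

end

lemma orthonormal_at_inner:
  assumes "orthonormal_at q I e" "A \<subseteq> I"
  shows "g q (\<Sum>a\<in>A. c a *\<^sub>R e a) (\<Sum>a\<in>A. d a *\<^sub>R e a) = (\<Sum>a\<in>A. c a * d a)"
proof -
  note I = orthonormal_atD[OF assms(1)]
  have T: "(\<Sum>a\<in>A. c a *\<^sub>R e a) \<in> TM q"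
    by (rule subspace_sum[OF subspace_TM]) (use I(3) assms(2) in \<open>auto intro: subspace_scale[OF subspace_TM]\<close>)
  have "g q (\<Sum>a\<in>A. c a *\<^sub>R e a) (\<Sum>a\<in>A. d a *\<^sub>R e a) = (\<Sum>b\<in>A. g q (\<Sum>a\<in>A. c a *\<^sub>R e a) (d b *\<^sub>R e b))"
    by (rule g_sum_right[OF I(1) T]) (use I(3) assms(2) in \<open>auto intro: subspace_scale[OF subspace_TM]\<close>)
  also have "\<dots> = (\<Sum>b\<in>A. c b * d b)"
  proof (rule sum.cong)
    fix b assume b: "b \<in> A"
    then have bI: "b \<in> I" using assms(2) by blast
    show "g q (\<Sum>a\<in>A. c a *\<^sub>R e a) (d b *\<^sub>R e b) = c b * d b"
      using g_scale_right[OF I(1) T I(3)[OF bI]] orthonormal_at_coeff[OF assms bI] b by simp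
  qed simp
  finally show ?thesis .
qed

section \<open>Second fundamental form, integrability tensor and mean curvature in an adapted
  frame\<close>

context
  fixes U I and E :: "'i \<Rightarrow> ('a, 'n) vfield" and A D
  assumes F: "frame_on TM U I E" and A: "A \<subseteq> I"
    and D: "\<And>q. q \<in> U \<Longrightarrow> D q = span ((\<lambda>a. E a q) ` A)"
begin

lemma frame_on_subbundle: "frame_on D U A E"
  unfolding frame_on_def
proof (intro conjI ballI)
  show "E a \<in> VF U" if "a \<in> A" for a
    using A that by (intro frame_VF[OF F]) blast
qed (simp_all add: frame_open[OF F] orthonormal_at_subset[OF frame_orthonormal[OF F] A] D)

lemma perp_proj_frame:
  assumes "p \<in> U" "v \<in> TM p"
  shows "perp_proj M D p v = (\<Sum>z\<in>I-A. g p v (E z p) *\<^sub>R E z p)"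
  by (rule perp_proj_eq[where e = "\<lambda>a. E a p" and D = D, OF frame_orthonormal[OF F assms(1)] frame_onD(4)[OF F assms(1)] A
        D[OF assms(1)] assms(2)])

lemma second_fundamental_form_frame:
  assumes "opn W" "p \<in> W" "p \<in> U" "Y \<in> VF W" "Z \<in> VF W"
  shows "second_fundamental_form M nabla D Y Z p =
    (\<Sum>z\<in>I-A. ((g p (nabla Y Z p) (E z p) + g p (nabla Z Y p) (E z p)) / 2) *\<^sub>R E z p)"
proof -
  note n = nabla_VF_TM[OF assms(1,4,5,2)] nabla_VF_TM[OF assms(1,5,4,2)]
  have "g p (nabla Y Z p + nabla Z Y p) (E z p) = g p (nabla Y Z p) (E z p) + g p (nabla Z Y p) (E z p)"
    if "z \<in> I" for z
    by (rule g_add_left[OF frame_topspace[OF F assms(3)] n frame_TM[OF F that assms(3)]])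
  then show ?thesis
    unfolding second_fundamental_form_def perp_proj_frame[OF assms(3) subspace_add[OF subspace_TM n]]
    by (simp add: scaleR_sum_right)
qed

lemma integrability_tensor_frame:
  assumes "opn W" "p \<in> W" "p \<in> U" "Y \<in> VF W" "Z \<in> VF W"
  shows "integrability_tensor M nabla D Y Z p =
    (\<Sum>z\<in>I-A. ((g p (nabla Y Z p) (E z p) - g p (nabla Z Y p) (E z p)) / 2) *\<^sub>R E z p)"
proof -
  note n = nabla_VF_TM[OF assms(1,4,5,2)] nabla_VF_TM[OF assms(1,5,4,2)]
  have "g p (nabla Y Z p - nabla Z Y p) (E z p) = g p (nabla Y Z p) (E z p) - g p (nabla Z Y p) (E z p)"
    if "z \<in> I" for z
    by (rule g_diff_left[OF frame_topspace[OF F assms(3)] n frame_TM[OF F that assms(3)]])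
  then show ?thesis
    unfolding integrability_tensor_def perp_proj_frame[OF assms(3) subspace_diff[OF subspace_TM n]]
    by (simp add: scaleR_sum_right)
qed

text \<open>The Leibniz rule produces derivatives of the coefficients of \<open>Z\<close>, but only
  in front of fields \<open>E t\<close> with \<open>t\<close> in \<open>A\<close>, which are
  orthogonal to \<open>E z\<close>. So the normal component is bilinear over functions in
  \<open>Y\<close> and \<open>Z\<close>.\<close>

lemma normal_component_expand:
  assumes W: "opn W" "W \<subseteq> U" "p \<in> W" and Y: "Y \<in> VF W" "\<And>q. q \<in> W \<Longrightarrow> Y q \<in> D q"
    and Z: "Z \<in> VF W" "\<And>q. q \<in> W \<Longrightarrow> Z q \<in> D q" and z: "z \<in> I - A"
  shows "g p (nabla Y Z p) (E z p) =
    (\<Sum>s\<in>A. \<Sum>t\<in>A. g p (Y p) (E s p) * g p (Z p) (E t p) * conn E s t z p)"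
proof -
  have p: "p \<in> U" and zI: "z \<in> I" using W(2,3) z by auto
  have FW: "frame_on D W A E" by (rule frame_on_subset[OF frame_on_subbundle W(1,2)])
  note EW = frame_onD(2)[OF FW] and t = frame_topspace[OF F p] and Ez = frame_TM[OF F zI p]
  have AI: "s \<in> I" if "s \<in> A" for s using that A by blast
  note ET = frame_TM[OF F AI p]
  note nT = frame_nabla_TM[OF F AI AI p]
  note sc = subspace_scale[OF subspace_TM]
  have 1: "g p (nabla (E s) Z p) (E z p) = (\<Sum>t\<in>A. g p (Z p) (E t p) * conn E s t z p)" if s: "s \<in> A" for s
  proof -
    define d where "d = (\<lambda>t. dir_deriv M p (E s p) (\<lambda>q. g q (Z q) (E t q)))"
    have "nabla (E s) Z p = (\<Sum>t\<in>A. d t *\<^sub>R E t p + g p (Z p) (E t p) *\<^sub>R nabla (E s) (E t) p)"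
      unfolding d_def by (rule nabla_expand_right[OF FW Z EW[OF s] W(3)])
    then have "g p (nabla (E s) Z p) (E z p)
        = g p (\<Sum>t\<in>A. d t *\<^sub>R E t p + g p (Z p) (E t p) *\<^sub>R nabla (E s) (E t) p) (E z p)"
      by (rule arg_cong)
    also have "\<dots> = (\<Sum>t\<in>A. g p (d t *\<^sub>R E t p + g p (Z p) (E t p) *\<^sub>R nabla (E s) (E t) p) (E z p))"
      by (rule g_sum_left[OF t Ez]) (intro subspace_add[OF subspace_TM] sc ET nT s)
    also have "\<dots> = (\<Sum>t\<in>A. g p (Z p) (E t p) * conn E s t z p)"
    proof (rule sum.cong)
      fix u assume u: "u \<in> A"
      have "g p (E u p) (E z p) = 0"
        using orthonormal_atD(4)[OF frame_orthonormal[OF F p] AI[OF u] zI] u z by auto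
      then show "g p (d u *\<^sub>R E u p + g p (Z p) (E u p) *\<^sub>R nabla (E s) (E u) p) (E z p)
          = g p (Z p) (E u p) * conn E s u z p"
        using g_add_left[OF t sc[OF ET[OF u]] sc[OF nT[OF s u]] Ez] g_scale_left[OF t ET[OF u] Ez]
          g_scale_left[OF t nT[OF s u] Ez]
        by (simp add: conn_def)
    qed simp
    finally show ?thesis .
  qed
  have nZ: "nabla (E s) Z p \<in> TM p" if "s \<in> A" for s
    by (rule nabla_VF_TM[OF W(1) EW[OF that] Z(1) W(3)])
  have "nabla Y Z p = (\<Sum>s\<in>A. g p (Y p) (E s p) *\<^sub>R nabla (E s) Z p)"
    by (rule nabla_expand_left[OF FW Y Z(1) W(3)])
  then have "g p (nabla Y Z p) (E z p) = g p (\<Sum>s\<in>A. g p (Y p) (E s p) *\<^sub>R nabla (E s) Z p) (E z p)"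
    by (rule arg_cong)
  also have "\<dots> = (\<Sum>s\<in>A. g p (g p (Y p) (E s p) *\<^sub>R nabla (E s) Z p) (E z p))"
    by (rule g_sum_left[OF t Ez]) (intro sc nZ)
  also have "\<dots> = (\<Sum>s\<in>A. g p (Y p) (E s p) * g p (nabla (E s) Z p) (E z p))"
    by (rule sum.cong) (simp_all add: g_scale_left[OF t nZ Ez])
  finally show ?thesis by (simp add: 1 sum_distrib_left mult.assoc)
qed

context
  fixes p assumes p: "p \<in> U"
begin

text \<open>The frame on which \<open>mean_curvature\<close> and \<open>form_norm2\<close> are
  evaluated at \<open>p\<close>. The next definition is its matrix relative to the adapted frame
  \<open>E\<close>.\<close>

private definition "G = frame_at M D p"
private definition "c a s = g p (G a p) (E s p)"

private lemma G_frame: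
  obtains W where "p \<in> W" "W \<subseteq> U" "frame_on D W {..<card A} G"
proof -
  obtain V where V: "p \<in> V" "frame_on D V {..<card A} G"
    unfolding G_def using frame_at_frame_on[OF frame_on_subbundle p] by blast
  have "opn (U \<inter> V)" using frame_open[OF F] frame_onD(1)[OF V(2)] by blast
  then have "frame_on D (U \<inter> V) {..<card A} G" by (intro frame_on_subset[OF V(2)]) auto
  then show ?thesis using that[of "U \<inter> V"] p V(1) by blast
qed

private lemma finite_A: "finite A"
  using A frame_finite[OF F p] finite_subset by blast

private lemma c_orthogonal:
  "s \<in> A \<Longrightarrow> t \<in> A \<Longrightarrow> (\<Sum>a<card A. c a s * c a t) = (if s = t then 1 else 0)"
proof -
  obtain W where W: "p \<in> W" "frame_on D W {..<card A} G" using G_frame .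
  have "span ((\<lambda>a. E a p) ` A) = span ((\<lambda>a. G a p) ` {..<card A})"
    using frame_onD(4)[OF W(2,1)] frame_onD(4)[OF frame_on_subbundle p] by simp
  from orthonormal_at_change[OF frame_onD(3)[OF frame_on_subbundle p] frame_onD(3)[OF W(2,1)] this]
  show "s \<in> A \<Longrightarrow> t \<in> A \<Longrightarrow> (\<Sum>a<card A. c a s * c a t) = (if s = t then 1 else 0)"
    unfolding c_def .
qed

private lemma G_normal:
  assumes "a < card A" "b < card A" "z \<in> I - A"
  shows "g p (nabla (G a) (G b) p) (E z p) = (\<Sum>s\<in>A. \<Sum>t\<in>A. c a s * c b t * conn E s t z p)"
proof -
  obtain W where W: "p \<in> W" "W \<subseteq> U" "frame_on D W {..<card A} G" using G_frame .
  note WD = frame_onD[OF W(3)]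
  have D': "G a q \<in> D q" if "q \<in> W" "a < card A" for q a
    using WD(4)[OF that(1)] span_base[of "G a q" "(\<lambda>a. G a q) ` {..<card A}"] that(2) by blast
  show ?thesis unfolding c_def
    by (rule normal_component_expand[OF WD(1) W(2,1)]) (use assms WD(2) D' in auto)
qed

text \<open>On the diagonal the two terms of \<open>h\<close> coincide, so each summand is the
  normal part of \<open>nabla (G a) (G a)\<close>; the trace rule then replaces \<open>G\<close> by
  \<open>E\<close>.\<close>

lemma mean_curvature_frame:
  "mean_curvature M nabla D p = (\<Sum>z\<in>I-A. (\<Sum>s\<in>A. conn E s s z p) *\<^sub>R E z p)"
proof -
  obtain W where W: "p \<in> W" "W \<subseteq> U" "frame_on D W {..<card A} G" using G_frame .
  note WD = frame_onD[OF W(3)]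
  have "mean_curvature M nabla D p = (\<Sum>a<card A. second_fundamental_form M nabla D (G a) (G a) p)"
    unfolding mean_curvature_def Let_def G_def[symmetric] frame_on_dim[OF frame_on_subbundle p] ..
  also have "\<dots> = (\<Sum>a<card A. \<Sum>z\<in>I-A. g p (nabla (G a) (G a) p) (E z p) *\<^sub>R E z p)"
    by (intro sum.cong refl) (simp add: second_fundamental_form_frame[OF WD(1) W(1) p] WD(2))
  also have "\<dots> = (\<Sum>z\<in>I-A. \<Sum>a<card A. g p (nabla (G a) (G a) p) (E z p) *\<^sub>R E z p)"
    by (rule sum.swap)
  also have "\<dots> = (\<Sum>z\<in>I-A. (\<Sum>a<card A. \<Sum>s\<in>A. \<Sum>t\<in>A. c a s * c a t * conn E s t z p) *\<^sub>R E z p)"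
    by (intro sum.cong refl) (simp add: scaleR_sum_left[symmetric] G_normal)
  also have "\<dots> = (\<Sum>z\<in>I-A. (\<Sum>s\<in>A. conn E s s z p) *\<^sub>R E z p)"
    by (simp add: trace_orthogonal_change[OF finite_A c_orthogonal])
  finally show ?thesis .
qed

lemma mean_curvature_norm2_frame:
  "g p (mean_curvature M nabla D p) (mean_curvature M nabla D p) = (\<Sum>z\<in>I-A. (\<Sum>s\<in>A. conn E s s z p)\<^sup>2)"
  unfolding mean_curvature_frame power2_eq_square
  by (rule orthonormal_at_inner[OF frame_orthonormal[OF F p]]) simp

text \<open>Polarization: the squares of half the sum and half the difference of
  \<open>b a a' z\<close> and \<open>b a' a z\<close> differ by the product of the two. This product
  is a contraction, which does not depend on the frame.\<close>

lemma form_norm2_diff_frame: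
  "form_norm2 M D (second_fundamental_form M nabla D) p - form_norm2 M D (integrability_tensor M nabla D) p
    = (\<Sum>z\<in>I-A. \<Sum>s\<in>A. \<Sum>t\<in>A. conn E s t z p * conn E t s z p)"
proof -
  obtain W where W: "p \<in> W" "W \<subseteq> U" "frame_on D W {..<card A} G" using G_frame .
  note WD = frame_onD[OF W(3)]
  define b where "b = (\<lambda>a a' z. g p (nabla (G a) (G a') p) (E z p))"
  note inner = orthonormal_at_inner[OF frame_orthonormal[OF F p], of "I - A"]
  have h: "form_norm2 M D (second_fundamental_form M nabla D) p
      = (\<Sum>a<card A. \<Sum>a'<card A. \<Sum>z\<in>I-A. ((b a a' z + b a' a z) / 2) * ((b a a' z + b a' a z) / 2))"
    unfolding form_norm2_def Let_def G_def[symmetric] frame_on_dim[OF frame_on_subbundle p] b_def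
    by (intro sum.cong refl) (simp add: second_fundamental_form_frame[OF WD(1) W(1) p] WD(2) inner)
  have T: "form_norm2 M D (integrability_tensor M nabla D) p
      = (\<Sum>a<card A. \<Sum>a'<card A. \<Sum>z\<in>I-A. ((b a a' z - b a' a z) / 2) * ((b a a' z - b a' a z) / 2))"
    unfolding form_norm2_def Let_def G_def[symmetric] frame_on_dim[OF frame_on_subbundle p] b_def
    by (intro sum.cong refl) (simp add: integrability_tensor_frame[OF WD(1) W(1) p] WD(2) inner)
  have "form_norm2 M D (second_fundamental_form M nabla D) p - form_norm2 M D (integrability_tensor M nabla D) p
      = (\<Sum>a<card A. \<Sum>a'<card A. \<Sum>z\<in>I-A. b a a' z * b a' a z)"
    unfolding h T sum_subtractf[symmetric] by (intro sum.cong refl) (simp add: field_simps)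
  also have "\<dots> = (\<Sum>a<card A. \<Sum>z\<in>I-A. \<Sum>a'<card A. b a a' z * b a' a z)"
    by (intro sum.cong refl sum.swap)
  also have "\<dots> = (\<Sum>z\<in>I-A. \<Sum>a<card A. \<Sum>a'<card A. b a a' z * b a' a z)"
    by (rule sum.swap)
  also have "\<dots> = (\<Sum>z\<in>I-A. \<Sum>a<card A. \<Sum>a'<card A.
      (\<Sum>s\<in>A. \<Sum>t\<in>A. c a s * c a' t * conn E s t z p) * (\<Sum>s\<in>A. \<Sum>t\<in>A. c a s * c a' t * conn E t s z p))"
  proof (intro sum.cong refl)
    fix z a a' assume z: "z \<in> I - A" and a: "a \<in> {..<card A}" "a' \<in> {..<card A}"
    \<comment> \<open>Renaming \<open>s\<close> and \<open>t\<close> brings the transposed factor to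
      the same coefficients \<open>c a s * c a' t\<close>, as the contraction rule requires.\<close>
    have "b a' a z = (\<Sum>s\<in>A. \<Sum>t\<in>A. c a s * c a' t * conn E t s z p)"
      unfolding b_def using G_normal[of a' a z] a z by (subst sum.swap) (simp add: mult.commute)
    then show "b a a' z * b a' a z = (\<Sum>s\<in>A. \<Sum>t\<in>A. c a s * c a' t * conn E s t z p) *
        (\<Sum>s\<in>A. \<Sum>t\<in>A. c a s * c a' t * conn E t s z p)"
      unfolding b_def using G_normal[of a a' z] a z by simp
  qed
  also have "\<dots> = (\<Sum>z\<in>I-A. \<Sum>s\<in>A. \<Sum>t\<in>A. conn E s t z p * conn E t s z p)"
    by (simp add: contraction_orthogonal_change[OF finite_A c_orthogonal])
  finally show ?thesis .
qed

end

end

end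

section \<open>Walczak's formula\<close>

lemma sum_antisym_zero:
  fixes u :: "'i \<Rightarrow> 'i \<Rightarrow> real"
  assumes "\<And>x s. x \<in> A \<Longrightarrow> s \<in> A \<Longrightarrow> u s x = - u x s"
  shows "(\<Sum>x\<in>A. \<Sum>s\<in>A. u x s) = 0"
proof -
  have "(\<Sum>x\<in>A. \<Sum>s\<in>A. u x s) = (\<Sum>s\<in>A. \<Sum>x\<in>A. u x s)" by (rule sum.swap)
  also have "\<dots> = (\<Sum>s\<in>A. \<Sum>x\<in>A. - u s x)" by (intro sum.cong refl assms)
  also have "\<dots> = - (\<Sum>x\<in>A. \<Sum>s\<in>A. u x s)" by (simp add: sum_negf)
  finally show ?thesis by simp
qed

text \<open>The left side is what the curvature contributes besides second derivatives. Every inner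
  sum is split over \<open>A\<close> and \<open>N\<close>, and skewness removes the parts that are
  antisymmetric in two summation indices. The first two sums on the right cancel the error terms of
  \<open>sum_second_derivatives\<close>.\<close>

lemma walczak_algebra:
  fixes w :: "'i \<Rightarrow> 'i \<Rightarrow> 'i \<Rightarrow> real"
  assumes fin: "finite I" and A: "A \<subseteq> I"
    and skew: "\<And>x y z. x \<in> I \<Longrightarrow> y \<in> I \<Longrightarrow> z \<in> I \<Longrightarrow> w x z y = - w x y z"
  defines "N \<equiv> I - A"
  shows "(\<Sum>x\<in>A. \<Sum>y\<in>N. (\<Sum>s\<in>I. w y x s * w x y s) + (\<Sum>s\<in>I. w x x s * w y y s)
        + (\<Sum>s\<in>I. (w x y s - w y x s) * w s x y))
    = (\<Sum>y\<in>N. \<Sum>s\<in>A. \<Sum>x\<in>A. w x x s * w y y s) + (\<Sum>y\<in>A. \<Sum>s\<in>N. \<Sum>x\<in>N. w x x s * w y y s)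
      - (\<Sum>z\<in>N. \<Sum>s\<in>A. \<Sum>t\<in>A. w s t z * w t s z) - (\<Sum>z\<in>A. \<Sum>s\<in>N. \<Sum>t\<in>N. w s t z * w t s z)"
proof -
  have AI: "x \<in> I" if "x \<in> A" for x using A that by blast
  have NI: "x \<in> I" if "x \<in> N" for x using that unfolding N_def by blast
  \<comment> \<open>All of the summand except the products \<open>w x x s * w y y s\<close>, which
    are only regrouped.\<close>
  define F where "F = (\<lambda>x y s. w y x s * w x y s + (w x y s - w y x s) * w s x y)"
  have split: "(\<Sum>s\<in>I. f s) = (\<Sum>s\<in>A. f s) + (\<Sum>s\<in>N. f s)" for f :: "'i \<Rightarrow> real"
    unfolding N_def using sum.subset_diff[OF A fin, of f] by (simp add: add.commute)
  have P1: "(\<Sum>x\<in>A. \<Sum>s\<in>A. F x y s) = - (\<Sum>s\<in>A. \<Sum>t\<in>A. w s t y * w t s y)" if y: "y \<in> N" for y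
  proof -
    \<comment> \<open>For fixed \<open>y\<close>, the factor \<open>w y x s\<close> is skew in
      \<open>x, s\<close> and the bracket is symmetric, so the first term cancels in the double sum
      over \<open>A\<close>.\<close>
    have "F x y s = - (w y x s * (w x s y + w s x y)) - w x s y * w s x y" if "x \<in> A" "s \<in> A" for x s
      using skew[of x s y] AI that NI[OF y] unfolding F_def by (simp add: algebra_simps)
    then have "(\<Sum>x\<in>A. \<Sum>s\<in>A. F x y s)
        = (\<Sum>x\<in>A. \<Sum>s\<in>A. - (w y x s * (w x s y + w s x y))) - (\<Sum>s\<in>A. \<Sum>t\<in>A. w s t y * w t s y)"
      by (simp add: sum_subtractf)
    also have "(\<Sum>x\<in>A. \<Sum>s\<in>A. - (w y x s * (w x s y + w s x y))) = 0"
    proof (rule sum_antisym_zero)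
      fix x s assume "x \<in> A" "s \<in> A"
      then show "- (w y s x * (w s x y + w x s y)) = - (- (w y x s * (w x s y + w s x y)))"
        using skew[of y x s] AI NI[OF y] by (simp add: algebra_simps)
    qed
    finally show ?thesis by simp
  qed
  have P2: "(\<Sum>y\<in>N. \<Sum>s\<in>N. F x y s) = - (\<Sum>s\<in>N. \<Sum>t\<in>N. w s t x * w t s x)" if x: "x \<in> A" for x
  proof -
    \<comment> \<open>The same with the roles exchanged: for fixed \<open>x\<close>, the factor
      \<open>w x y s\<close> is skew in \<open>y, s\<close>.\<close>
    have "F x y s = - (w x y s * (w y s x + w s y x)) - w y s x * w s y x" if "y \<in> N" "s \<in> N" for y s
      using skew[of y s x] skew[of s y x] NI that AI[OF x] unfolding F_def by (simp add: algebra_simps)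
    then have "(\<Sum>y\<in>N. \<Sum>s\<in>N. F x y s)
        = (\<Sum>y\<in>N. \<Sum>s\<in>N. - (w x y s * (w y s x + w s y x))) - (\<Sum>s\<in>N. \<Sum>t\<in>N. w s t x * w t s x)"
      by (simp add: sum_subtractf)
    also have "(\<Sum>y\<in>N. \<Sum>s\<in>N. - (w x y s * (w y s x + w s y x))) = 0"
    proof (rule sum_antisym_zero)
      fix y s assume "y \<in> N" "s \<in> N"
      then show "- (w x s y * (w s y x + w y s x)) = - (- (w x y s * (w y s x + w s y x)))"
        using skew[of x y s] NI AI[OF x] by (simp add: algebra_simps)
    qed
    finally show ?thesis by simp
  qed
  have "(\<Sum>x\<in>A. \<Sum>y\<in>N. (\<Sum>s\<in>I. w y x s * w x y s) + (\<Sum>s\<in>I. w x x s * w y y s)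
        + (\<Sum>s\<in>I. (w x y s - w y x s) * w s x y))
    = (\<Sum>x\<in>A. \<Sum>y\<in>N. (\<Sum>s\<in>I. w x x s * w y y s) + (\<Sum>s\<in>I. F x y s))"
    unfolding F_def sum.distrib by (simp add: algebra_simps)
  also have "\<dots> = (\<Sum>x\<in>A. \<Sum>y\<in>N. \<Sum>s\<in>A. w x x s * w y y s) + (\<Sum>x\<in>A. \<Sum>y\<in>N. \<Sum>s\<in>N. w x x s * w y y s)
      + (\<Sum>x\<in>A. \<Sum>y\<in>N. \<Sum>s\<in>A. F x y s) + (\<Sum>x\<in>A. \<Sum>y\<in>N. \<Sum>s\<in>N. F x y s)"
    unfolding split by (simp add: sum.distrib)
  also have "(\<Sum>x\<in>A. \<Sum>y\<in>N. \<Sum>s\<in>A. F x y s) = (\<Sum>y\<in>N. \<Sum>x\<in>A. \<Sum>s\<in>A. F x y s)"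
    by (rule sum.swap)
  also have "\<dots> = - (\<Sum>z\<in>N. \<Sum>s\<in>A. \<Sum>t\<in>A. w s t z * w t s z)"
    by (simp add: P1 sum_negf)
  also have "(\<Sum>x\<in>A. \<Sum>y\<in>N. \<Sum>s\<in>N. F x y s) = - (\<Sum>z\<in>A. \<Sum>s\<in>N. \<Sum>t\<in>N. w s t z * w t s z)"
    by (simp add: P2 sum_negf)
  also have "(\<Sum>x\<in>A. \<Sum>y\<in>N. \<Sum>s\<in>A. w x x s * w y y s) = (\<Sum>y\<in>N. \<Sum>x\<in>A. \<Sum>s\<in>A. w x x s * w y y s)"
    by (rule sum.swap)
  also have "\<dots> = (\<Sum>y\<in>N. \<Sum>s\<in>A. \<Sum>x\<in>A. w x x s * w y y s)"
    by (intro sum.cong refl sum.swap)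
  also have "(\<Sum>x\<in>A. \<Sum>y\<in>N. \<Sum>s\<in>N. w x x s * w y y s) = (\<Sum>y\<in>A. \<Sum>s\<in>N. \<Sum>x\<in>N. w x x s * w y y s)"
    by (rule sum.cong[OF refl], subst sum.swap) (simp only: mult.commute)
  finally show ?thesis by simp
qed

context riemannian_connection
begin

context
  fixes U I and E :: "'i \<Rightarrow> ('a, 'n) vfield"
  assumes F: "frame_on TM U I E"
begin

section \<open>Mean curvature fields and traces of second derivatives\<close>

lemma g_parseval:
  assumes "p \<in> U" "u \<in> TM p" "v \<in> TM p"
  shows "g p u v = (\<Sum>s\<in>I. g p u (E s p) * g p v (E s p))"
proof -
  note o = frame_orthonormal[OF F assms(1)] and sp = frame_onD(4)[OF F assms(1)]
  have "g p u v = g p (\<Sum>s\<in>I. g p u (E s p) *\<^sub>R E s p) (\<Sum>s\<in>I. g p v (E s p) *\<^sub>R E s p)"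
    by (rule arg_cong2[OF orthonormal_at_expand[OF o] orthonormal_at_expand[OF o]]) (use sp assms in auto)
  then show ?thesis using orthonormal_at_inner[OF o order_refl] by simp
qed

lemma conn_g_nabla:
  assumes "p \<in> U" "x \<in> I" "y \<in> I" "u \<in> I" "v \<in> I"
  shows "g p (nabla (E x) (E y) p) (nabla (E u) (E v) p) = (\<Sum>s\<in>I. conn E x y s p * conn E u v s p)"
  unfolding conn_def by (rule g_parseval[OF assms(1) frame_nabla_TM[OF F assms(2,3,1)] frame_nabla_TM[OF F assms(4,5,1)]])

text \<open>By \<open>mean_curvature_frame\<close> this agrees on \<open>U\<close> with the mean
  curvature of the distribution spanned by \<open>A\<close>. As \<open>mean_curvature\<close>
  chooses a new frame at each point, its smoothness is obtained from this single formula.\<close>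

definition mean_field :: "'i set \<Rightarrow> ('a, 'n) vfield" where
  "mean_field A = (\<Sum>z\<in>I-A. \<Sum>s\<in>A. (\<lambda>q. conn E s s z q *\<^sub>R E z q))"

lemma mean_field_apply: "mean_field A q = (\<Sum>z\<in>I-A. (\<Sum>s\<in>A. conn E s s z q) *\<^sub>R E z q)"
  unfolding mean_field_def by (simp add: sum_fun_apply scaleR_sum_left)

lemma mean_field_VF: "A \<subseteq> I \<Longrightarrow> mean_field A \<in> VF U"
  unfolding mean_field_def conn_def
  by (intro VF_sum frame_open[OF F] VF_scale smooth_fun_g nabla_VF frame_VF[OF F]) auto

lemma mean_field_coeff:
  assumes "A \<subseteq> I" "q \<in> U" "z \<in> I"
  shows "g q (mean_field A q) (E z q) = (if z \<in> A then 0 else \<Sum>s\<in>A. conn E s s z q)"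
  unfolding mean_field_apply
  using orthonormal_at_coeff[OF frame_orthonormal[OF F assms(2)], of "I - A" z] assms by auto

text \<open>The sum \<open>N\<close> of the fields \<open>nabla (E x) (E x)\<close> over
  \<open>A\<close> splits into a normal part \<open>H\<close> and a tangential part
  \<open>T\<close>. For \<open>H\<close>, the trace over \<open>I - A\<close> is the divergence
  minus the trace over \<open>A\<close>; for \<open>T\<close> it consists of products of
  coefficients.\<close>

lemma sum_second_derivatives:
  assumes A: "A \<subseteq> I" and p: "p \<in> U"
  shows "(\<Sum>x\<in>A. \<Sum>y\<in>I-A. g p (nabla (E y) (nabla (E x) (E x)) p) (E y p))
    = divergence M nabla (mean_field A) p + (\<Sum>z\<in>I-A. (\<Sum>s\<in>A. conn E s s z p)\<^sup>2)
      - (\<Sum>y\<in>I-A. \<Sum>s\<in>A. \<Sum>x\<in>A. conn E x x s p * conn E y y s p)"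
proof -
  note U = frame_open[OF F] and t = frame_topspace[OF F]
  have AI: "x \<in> I" if "x \<in> A" for x using A that by blast
  define H where "H = mean_field A"
  have H: "H \<in> VF U" unfolding H_def by (rule mean_field_VF[OF A])
  have nE: "nabla (E x) (E x) \<in> VF U" if "x \<in> A" for x
    using nabla_VF[OF U frame_VF[OF F AI[OF that]] frame_VF[OF F AI[OF that]]] .
  define N where "N = (\<Sum>x\<in>A. nabla (E x) (E x))"
  have N: "N \<in> VF U" unfolding N_def by (rule VF_sum[OF U nE])
  \<comment> \<open>\<open>H\<close> has exactly the normal components of \<open>N\<close>, so
    \<open>T\<close> is tangential to the span of \<open>A\<close>.\<close>
  define T where "T = N - H"
  have T: "T \<in> VF U" unfolding T_def by (rule VF_diff[OF U N H])
  have N_coeff: "g q (N q) (E z q) = (\<Sum>x\<in>A. conn E x x z q)" if q: "q \<in> U" and z: "z \<in> I" for q z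
    unfolding N_def sum_fun_apply[of _ _ q] conn_def
    by (rule g_sum_left[OF t[OF q] frame_TM[OF F z q]]) (rule frame_nabla_TM[OF F AI AI q])
  have T_coeff: "g q (T q) (E z q) = (if z \<in> A then \<Sum>x\<in>A. conn E x x z q else 0)"
    if q: "q \<in> U" and z: "z \<in> I" for q z
    using g_diff_left[OF t[OF q] VF_TM[OF N q] VF_TM[OF H q] frame_TM[OF F z q]] N_coeff[OF q z]
      mean_field_coeff[OF A q z] by (simp add: T_def H_def)
  have nT: "nabla (E y) (E y) p \<in> TM p" if "y \<in> I" for y
    by (rule frame_nabla_TM[OF F that that p])
  \<comment> \<open>\<open>T\<close> is orthogonal to \<open>E y\<close> on all of \<open>U\<close>,
    so the derivative moves onto \<open>E y\<close> with a minus sign.\<close>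
  have 1: "g p (nabla (E y) T p) (E y p) = - (\<Sum>s\<in>A. \<Sum>x\<in>A. conn E x x s p * conn E y y s p)"
    if y: "y \<in> I - A" for y
  proof -
    have yI: "y \<in> I" using y by blast
    have "g p (nabla (E y) T p) (E y p) = - g p (T p) (nabla (E y) (E y) p)"
      by (rule nabla_metric_const[OF U frame_VF[OF F yI] T frame_VF[OF F yI] p, of 0])
        (use T_coeff yI y in simp)
    also have "g p (T p) (nabla (E y) (E y) p) = (\<Sum>s\<in>I. g p (T p) (E s p) * conn E y y s p)"
      unfolding conn_def by (rule g_parseval[OF p VF_TM[OF T p] nT[OF yI]])
    also have "\<dots> = (\<Sum>s\<in>A. g p (T p) (E s p) * conn E y y s p)"
      by (rule sum.mono_neutral_right) (use A frame_finite[OF F p] T_coeff[OF p] in auto)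
    also have "\<dots> = (\<Sum>s\<in>A. \<Sum>x\<in>A. conn E x x s p * conn E y y s p)"
      by (rule sum.cong) (simp_all add: T_coeff[OF p AI] sum_distrib_right)
    finally show ?thesis .
  qed
  \<comment> \<open>Likewise \<open>H\<close> is orthogonal to \<open>E a\<close>. Summed over
    \<open>A\<close>, this trace is minus the squared length of \<open>H\<close>.\<close>
  have 2: "g p (nabla (E a) H p) (E a p) = - (\<Sum>z\<in>I-A. (\<Sum>s\<in>A. conn E s s z p) * conn E a a z p)"
    if a: "a \<in> A" for a
  proof -
    have "g p (nabla (E a) H p) (E a p) = - g p (H p) (nabla (E a) (E a) p)"
      by (rule nabla_metric_const[OF U frame_VF[OF F AI[OF a]] H frame_VF[OF F AI[OF a]] p, of 0])
        (use mean_field_coeff[OF A _ AI[OF a]] a in \<open>simp add: H_def\<close>)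
    also have "g p (H p) (nabla (E a) (E a) p) = (\<Sum>s\<in>I. g p (H p) (E s p) * conn E a a s p)"
      unfolding conn_def by (rule g_parseval[OF p VF_TM[OF H p] nT[OF AI[OF a]]])
    also have "\<dots> = (\<Sum>z\<in>I-A. g p (H p) (E z p) * conn E a a z p)"
      by (rule sum.mono_neutral_right) (use A frame_finite[OF F p] mean_field_coeff[OF A p] in \<open>auto simp: H_def\<close>)
    also have "\<dots> = (\<Sum>z\<in>I-A. (\<Sum>s\<in>A. conn E s s z p) * conn E a a z p)"
      by (rule sum.cong) (simp_all add: H_def mean_field_coeff[OF A p])
    finally show ?thesis .
  qed
  have "divergence M nabla H p = (\<Sum>y\<in>I-A. g p (nabla (E y) H p) (E y p)) + (\<Sum>a\<in>A. g p (nabla (E a) H p) (E a p))"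
    unfolding divergence_frame[OF F H p] by (rule sum.subset_diff[OF A frame_finite[OF F p]])
  also have "(\<Sum>a\<in>A. g p (nabla (E a) H p) (E a p))
      = - (\<Sum>a\<in>A. \<Sum>z\<in>I-A. (\<Sum>s\<in>A. conn E s s z p) * conn E a a z p)"
    by (simp add: 2 sum_negf)
  also have "(\<Sum>a\<in>A. \<Sum>z\<in>I-A. (\<Sum>s\<in>A. conn E s s z p) * conn E a a z p)
      = (\<Sum>z\<in>I-A. \<Sum>a\<in>A. (\<Sum>s\<in>A. conn E s s z p) * conn E a a z p)" by (rule sum.swap)
  also have "\<dots> = (\<Sum>z\<in>I-A. (\<Sum>s\<in>A. conn E s s z p)\<^sup>2)"
    by (simp add: sum_distrib_left[symmetric] power2_eq_square)
  finally have divH: "(\<Sum>y\<in>I-A. g p (nabla (E y) H p) (E y p))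
      = divergence M nabla H p + (\<Sum>z\<in>I-A. (\<Sum>s\<in>A. conn E s s z p)\<^sup>2)" by simp
  have 3: "(\<Sum>x\<in>A. g p (nabla (E y) (nabla (E x) (E x)) p) (E y p))
      = g p (nabla (E y) H p) (E y p) + g p (nabla (E y) T p) (E y p)" if y: "y \<in> I - A" for y
  proof -
    have yI: "y \<in> I" using y by blast
    note Ey = frame_VF[OF F yI]
    have nn: "nabla (E y) (nabla (E x) (E x)) p \<in> TM p" if "x \<in> A" for x
      by (rule nabla_VF_TM[OF U Ey nE[OF that] p])
    have "(\<Sum>x\<in>A. nabla (E y) (nabla (E x) (E x)) p) = nabla (E y) N p"
      unfolding N_def by (rule nabla_sum_right[OF U nE Ey p, symmetric])
    also have "N = H + T" by (simp add: T_def)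
    also have "nabla (E y) (H + T) p = nabla (E y) H p + nabla (E y) T p"
      by (rule nabla_add_right[OF U Ey H p T])
    finally have "(\<Sum>x\<in>A. nabla (E y) (nabla (E x) (E x)) p) = nabla (E y) H p + nabla (E y) T p" .
    then have "g p (\<Sum>x\<in>A. nabla (E y) (nabla (E x) (E x)) p) (E y p)
        = g p (nabla (E y) H p) (E y p) + g p (nabla (E y) T p) (E y p)"
      using g_add_left[OF t[OF p] nabla_VF_TM[OF U Ey H p] nabla_VF_TM[OF U Ey T p] VF_TM[OF Ey p]] by simp
    then show ?thesis using g_sum_left[OF t[OF p] VF_TM[OF Ey p] nn, of A "\<lambda>x. x"] by simp
  qed
  have "(\<Sum>x\<in>A. \<Sum>y\<in>I-A. g p (nabla (E y) (nabla (E x) (E x)) p) (E y p))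
      = (\<Sum>y\<in>I-A. \<Sum>x\<in>A. g p (nabla (E y) (nabla (E x) (E x)) p) (E y p))"
    by (rule sum.swap)
  also have "\<dots> = (\<Sum>y\<in>I-A. g p (nabla (E y) H p) (E y p)) + (\<Sum>y\<in>I-A. g p (nabla (E y) T p) (E y p))"
    by (simp add: 3 sum.distrib)
  also have "(\<Sum>y\<in>I-A. g p (nabla (E y) T p) (E y p))
      = - (\<Sum>y\<in>I-A. \<Sum>s\<in>A. \<Sum>x\<in>A. conn E x x s p * conn E y y s p)"
    by (simp add: 1 sum_negf)
  finally show ?thesis using divH by (simp add: H_def)
qed

text \<open>Vanishing torsion replaces the bracket by
  \<open>nabla (E x) (E y) - nabla (E y) (E x)\<close>, and the derivative along this field expands
  linearly in the frame.\<close>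

lemma curvature_frame:
  assumes p: "p \<in> U" and xyz: "x \<in> I" "y \<in> I" "z \<in> I" "w \<in> I"
  shows "g p (curvature M nabla (E x) (E y) (E z) p) (E w p)
    = g p (nabla (E y) (nabla (E x) (E z)) p) (E w p) - g p (nabla (E x) (nabla (E y) (E z)) p) (E w p)
      + (\<Sum>s\<in>I. (conn E x y s p - conn E y x s p) * conn E s z w p)"
proof -
  note U = frame_open[OF F] and t = frame_topspace[OF F p] and V = frame_VF[OF F]
  note n = nabla_VF[OF U]
  have L: "nabla (E x) (E y) - nabla (E y) (E x) \<in> VF U"
    by (intro VF_diff[OF U] n V xyz)
  define Z where "Z = nabla (lie_bracket M (E x) (E y)) (E z) p"
  \<comment> \<open>The torsion identity is an equality at the points of \<open>U\<close>, so
    locality of the connection is used to substitute it.\<close>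
  have "nabla (nabla (E x) (E y) - nabla (E y) (E x)) (E z) p = Z"
    unfolding Z_def by (rule nabla_cong[OF U L V[OF xyz(3)] p _ refl])
      (simp add: nabla_torsion[OF U V[OF xyz(1)] V[OF xyz(2)]])
  moreover have "nabla (nabla (E x) (E y) - nabla (E y) (E x)) (E z) p
      = (\<Sum>s\<in>I. g p ((nabla (E x) (E y) - nabla (E y) (E x)) p) (E s p) *\<^sub>R nabla (E s) (E z) p)"
    by (rule nabla_frame_expand[OF F L V[OF xyz(3)] p])
  moreover have "g p ((nabla (E x) (E y) - nabla (E y) (E x)) p) (E s p) = conn E x y s p - conn E y x s p"
    if "s \<in> I" for s
    using g_diff_left[OF t frame_nabla_TM[OF F xyz(1,2) p] frame_nabla_TM[OF F xyz(2,1) p] frame_TM[OF F that p]]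
    by (simp add: conn_def)
  ultimately have Z: "Z = (\<Sum>s\<in>I. (conn E x y s p - conn E y x s p) *\<^sub>R nabla (E s) (E z) p)"
    by simp
  have nT: "nabla (E s) (E z) p \<in> TM p" if "s \<in> I" for s by (rule frame_nabla_TM[OF F that xyz(3) p])
  note Ew = frame_TM[OF F xyz(4) p]
  have ZT: "Z \<in> TM p"
    unfolding Z by (intro subspace_sum[OF subspace_TM] subspace_scale[OF subspace_TM] nT)
  have "g p Z (E w p) = (\<Sum>s\<in>I. g p ((conn E x y s p - conn E y x s p) *\<^sub>R nabla (E s) (E z) p) (E w p))"
    unfolding Z by (rule g_sum_left[OF t Ew]) (intro subspace_scale[OF subspace_TM] nT)
  also have "\<dots> = (\<Sum>s\<in>I. (conn E x y s p - conn E y x s p) * conn E s z w p)"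
    by (rule sum.cong) (simp_all add: g_scale_left[OF t nT Ew] conn_def)
  finally have gZ: "g p Z (E w p) = (\<Sum>s\<in>I. (conn E x y s p - conn E y x s p) * conn E s z w p)" .
  note a = VF_TM[OF n[OF V[OF xyz(2)] n[OF V[OF xyz(1)] V[OF xyz(3)]]] p]
    and b = VF_TM[OF n[OF V[OF xyz(1)] n[OF V[OF xyz(2)] V[OF xyz(3)]]] p]
  have "curvature M nabla (E x) (E y) (E z) p
      = nabla (E y) (nabla (E x) (E z)) p - nabla (E x) (nabla (E y) (E z)) p + Z"
    by (simp add: curvature_def Z_def)
  then show ?thesis
    using g_add_left[OF t subspace_diff[OF subspace_TM a b] ZT Ew] g_diff_left[OF t a b Ew] gZ
    by simp
qed

text \<open>The constant inner product of \<open>E z\<close> and \<open>E w\<close> differentiated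
  twice: \<open>z\<close> and \<open>w\<close> can be exchanged up to sign and products of
  coefficients.\<close>

lemma frame_nabla_nabla:
  assumes p: "p \<in> U" and I: "x \<in> I" "y \<in> I" "z \<in> I" "w \<in> I"
  shows "g p (nabla (E x) (nabla (E y) (E z)) p) (E w p)
    = - (\<Sum>s\<in>I. conn E y z s p * conn E x w s p) - (\<Sum>s\<in>I. conn E x z s p * conn E y w s p)
      - g p (nabla (E x) (nabla (E y) (E w)) p) (E z p)"
proof -
  note U = frame_open[OF F] and V = frame_VF[OF F]
  have "g p (E z p) (nabla (E x) (nabla (E y) (E w)) p) = g p (nabla (E x) (nabla (E y) (E w)) p) (E z p)"
    by (intro g_sym frame_topspace[OF F p] frame_TM[OF F] nabla_VF_TM[OF U] nabla_VF[OF U] V I p)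
  then show ?thesis
    using nabla_nabla_metric_const[OF U V[OF I(1)] V[OF I(2)] V[OF I(3)] V[OF I(4)] p,
        of "if z = w then 1 else 0"] orthonormal_atD(4)[OF frame_orthonormal[OF F] I(3,4)]
    by (simp add: conn_g_nabla[OF p] I)
qed

text \<open>Exchanging the last two frame fields in both second derivatives by
  \<open>frame_nabla_nabla\<close> produces the same products of coefficients, which cancel in the
  difference. The bracket terms agree by skewness.\<close>

lemma curvature_frame_sym:
  assumes p: "p \<in> U" and xy: "x \<in> I" "y \<in> I"
  shows "g p (curvature M nabla (E x) (E y) (E x) p) (E y p) = g p (curvature M nabla (E y) (E x) (E y) p) (E x p)"
proof -
  have "(\<Sum>s\<in>I. (conn E x y s p - conn E y x s p) * conn E s x y p)
      = (\<Sum>s\<in>I. (conn E y x s p - conn E x y s p) * conn E s y x p)"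
  proof (rule sum.cong)
    fix s assume "s \<in> I"
    then show "(conn E x y s p - conn E y x s p) * conn E s x y p = (conn E y x s p - conn E x y s p) * conn E s y x p"
      using conn_skew[OF F _ xy p, of s] by (simp add: algebra_simps)
  qed simp
  then show ?thesis
    using frame_nabla_nabla[OF p xy xy] frame_nabla_nabla[OF p xy(2,1) xy]
    unfolding curvature_frame[OF p xy xy] curvature_frame[OF p xy(2,1) xy(2,1)]
    by (simp add: mult.commute)
qed

text \<open>Walczak's formula at \<open>p\<close> in frame form: the trace of second derivatives is
  taken for \<open>A\<close> and for \<open>I - A\<close>, and \<open>walczak_algebra\<close>
  handles the remaining products.\<close>

lemma walczak_frame:
  assumes A: "A \<subseteq> I" and p: "p \<in> U"
  shows "divergence M nabla (mean_field A) p + divergence M nabla (mean_field (I - A)) p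
    = (\<Sum>x\<in>A. \<Sum>y\<in>I-A. g p (curvature M nabla (E x) (E y) (E x) p) (E y p))
      + ((\<Sum>z\<in>I-A. \<Sum>s\<in>A. \<Sum>t\<in>A. conn E s t z p * conn E t s z p) - (\<Sum>z\<in>I-A. (\<Sum>s\<in>A. conn E s s z p)\<^sup>2))
      + ((\<Sum>z\<in>A. \<Sum>s\<in>I-A. \<Sum>t\<in>I-A. conn E s t z p * conn E t s z p) - (\<Sum>z\<in>A. (\<Sum>s\<in>I-A. conn E s s z p)\<^sup>2))"
proof -
  have NA: "I - (I - A) = A" using A by blast
  \<comment> \<open>The term \<open>nabla (E x) (nabla (E y) (E x))\<close> paired with
    \<open>E y\<close> is exchanged for \<open>nabla (E x) (nabla (E y) (E y))\<close> paired with
    \<open>E x\<close>. Both second derivatives then have the form treated in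
    \<open>sum_second_derivatives\<close>.\<close>
  have K: "g p (curvature M nabla (E x) (E y) (E x) p) (E y p)
      = g p (nabla (E y) (nabla (E x) (E x)) p) (E y p) + g p (nabla (E x) (nabla (E y) (E y)) p) (E x p)
        + ((\<Sum>s\<in>I. conn E y x s p * conn E x y s p) + (\<Sum>s\<in>I. conn E x x s p * conn E y y s p)
        + (\<Sum>s\<in>I. (conn E x y s p - conn E y x s p) * conn E s x y p))"
    if "x \<in> A" "y \<in> I - A" for x y
  proof -
    have xy: "x \<in> I" "y \<in> I" using that A by auto
    show ?thesis
      using curvature_frame[OF p xy xy] frame_nabla_nabla[OF p xy xy] by simp
  qed
  have "(\<Sum>x\<in>A. \<Sum>y\<in>I-A. g p (nabla (E x) (nabla (E y) (E y)) p) (E x p))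
      = (\<Sum>y\<in>I-A. \<Sum>x\<in>A. g p (nabla (E x) (nabla (E y) (E y)) p) (E x p))"
    by (rule sum.swap)
  also have "\<dots> = divergence M nabla (mean_field (I - A)) p + (\<Sum>z\<in>A. (\<Sum>s\<in>I-A. conn E s s z p)\<^sup>2)
      - (\<Sum>y\<in>A. \<Sum>s\<in>I-A. \<Sum>x\<in>I-A. conn E x x s p * conn E y y s p)"
    using sum_second_derivatives[OF Diff_subset p, of A] unfolding NA .
  finally have 2: "(\<Sum>x\<in>A. \<Sum>y\<in>I-A. g p (nabla (E x) (nabla (E y) (E y)) p) (E x p))
      = divergence M nabla (mean_field (I - A)) p + (\<Sum>z\<in>A. (\<Sum>s\<in>I-A. conn E s s z p)\<^sup>2)
      - (\<Sum>y\<in>A. \<Sum>s\<in>I-A. \<Sum>x\<in>I-A. conn E x x s p * conn E y y s p)" .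
  have "(\<Sum>x\<in>A. \<Sum>y\<in>I-A. g p (curvature M nabla (E x) (E y) (E x) p) (E y p))
      = (\<Sum>x\<in>A. \<Sum>y\<in>I-A. g p (nabla (E y) (nabla (E x) (E x)) p) (E y p))
      + (\<Sum>x\<in>A. \<Sum>y\<in>I-A. g p (nabla (E x) (nabla (E y) (E y)) p) (E x p))
      + (\<Sum>x\<in>A. \<Sum>y\<in>I-A. (\<Sum>s\<in>I. conn E y x s p * conn E x y s p) + (\<Sum>s\<in>I. conn E x x s p * conn E y y s p)
        + (\<Sum>s\<in>I. (conn E x y s p - conn E y x s p) * conn E s x y p))"
    unfolding sum.distrib[symmetric] by (intro sum.cong refl) (use K in \<open>simp add: sum.distrib\<close>)
  then show ?thesis
    using walczak_algebra[OF frame_finite[OF F p] A, of "\<lambda>x y z. conn E x y z p", OF conn_skew[OF F _ _ _ p]]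
      sum_second_derivatives[OF A p] 2
    by simp
qed

end

end

section \<open>Adapted frames for almost product structures\<close>

lemma bij_betw_index_sets_1: "bij_betw (\<lambda>i. {i}) {1..k} (index_sets 1 k)"
  unfolding bij_betw_def index_sets_def by (auto simp: card_1_singleton_iff)

lemma bij_betw_index_sets_complement:
  assumes "1 \<le> k"
  shows "bij_betw (\<lambda>i. {1..k} - {i}) {1..k} (index_sets (k - 1) k)"
  unfolding bij_betw_def
proof
  show "inj_on (\<lambda>i. {1..k} - {i}) {1..k}" by (rule inj_onI) blast
  show "(\<lambda>i. {1..k} - {i}) ` {1..k} = index_sets (k - 1) k"
  proof (intro antisym subsetI)
    fix q assume "q \<in> index_sets (k - 1) k"
    then have q: "q \<subseteq> {1..k}" "card q = k - 1" by (auto simp: index_sets_def)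
    have "card ({1..k} - q) = 1"
      using q assms finite_subset[OF q(1)] by (subst card_Diff_subset) auto
    then obtain i where i: "{1..k} - q = {i}" by (auto simp: card_1_singleton_iff)
    then have "q = {1..k} - {i}" "i \<in> {1..k}" using q(1) by auto
    then show "q \<in> (\<lambda>i. {1..k} - {i}) ` {1..k}" by blast
  qed (auto simp: index_sets_def)
qed

text \<open>The entry 1 runs over the sets \<open>{i}\<close> and the entry \<open>k - 1\<close>
  over their complements, so each \<open>i\<close> contributes one complementary pair. For
  \<open>k = 2\<close> both sides count every singleton twice.\<close>

lemma sum_index_sets:
  assumes "1 \<le> k"
  shows "(\<Sum>r\<leftarrow>[1, k - 1]. \<Sum>q\<in>index_sets r k. f q) = (\<Sum>i=1..k. f {i} + f ({1..k} - {i}))"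
  using sum.reindex_bij_betw[OF bij_betw_index_sets_1, of f k]
    sum.reindex_bij_betw[OF bij_betw_index_sets_complement[OF assms], of f]
  by (simp add: sum.distrib)

text \<open>The off-diagonal pairs are those with \<open>i < j\<close> and their mirror images; this
  is the source of the factor 2 in front of the mixed scalar curvature.\<close>

lemma sum_off_diagonal_symmetric:
  fixes f :: "nat \<Rightarrow> nat \<Rightarrow> real"
  assumes "\<And>i j. i \<in> {1..k} \<Longrightarrow> j \<in> {1..k} \<Longrightarrow> f i j = f j i"
  shows "(\<Sum>i=1..k. \<Sum>j\<in>{1..k} - {i}. f i j) = 2 * (\<Sum>(i, j) | 1 \<le> i \<and> i < j \<and> j \<le> k. f i j)"
proof -
  define S where "S = {(i, j). 1 \<le> i \<and> i < j \<and> j \<le> k}"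
  define F where "F = (\<lambda>(i, j). f i j)"
  have S: "S \<subseteq> {1..k} \<times> {1..k}" by (auto simp: S_def)
  then have fin: "finite S" by (rule finite_subset) simp
  have "(\<Sum>i=1..k. \<Sum>j\<in>{1..k} - {i}. f i j) = sum F (SIGMA i:{1..k}. {1..k} - {i})"
    unfolding F_def by (rule sum.Sigma) auto
  also have "(SIGMA i:{1..k}. {1..k} - {i}) = S \<union> prod.swap ` S"
  proof (intro antisym subsetI)
    fix x assume x: "x \<in> (SIGMA i:{1..k}. {1..k} - {i})"
    then have "x \<in> S \<or> prod.swap x \<in> S" by (auto simp: S_def)
    then show "x \<in> S \<union> prod.swap ` S"
      by (metis UnCI image_eqI swap_swap)
  qed (auto simp: S_def)
  also have "sum F \<dots> = sum F S + sum F (prod.swap ` S)"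
    by (rule sum.union_disjoint) (use fin in \<open>auto simp: S_def\<close>)
  also have "sum F (prod.swap ` S) = sum (F \<circ> prod.swap) S"
    by (rule sum.reindex) (auto simp: inj_on_def)
  also have "\<dots> = sum F S"
    using S assms by (intro sum.cong) (auto simp: F_def)
  finally show ?thesis by (simp add: S_def F_def)
qed

lemma span_Union_span: "span (\<Union>i\<in>q. span (S i)) = span (\<Union>i\<in>q. S i)"
proof
  show "span (\<Union>i\<in>q. span (S i)) \<subseteq> span (\<Union>i\<in>q. S i)"
    by (rule span_minimal[OF _ subspace_span]) (auto intro: subsetD[OF span_mono, rotated])
  show "span (\<Union>i\<in>q. S i) \<subseteq> span (\<Union>i\<in>q. span (S i))"
    by (rule span_mono) (auto intro: span_base)
qed

context riemannian_connection
begin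

context
  fixes U I and E :: "'i \<Rightarrow> ('a, 'n) vfield" and p
  assumes F: "frame_on TM U I E" and p: "p \<in> U"
begin

section \<open>Locality and additivity of the divergence\<close>

lemma divergence_cong:
  assumes "X \<in> VF U" "\<And>q. q \<in> U \<Longrightarrow> X q = Y q"
  shows "divergence M nabla X p = divergence M nabla Y p"
proof -
  have Y: "Y \<in> VF U" by (rule VF_cong[OF frame_open[OF F] assms])
  have "nabla (E s) X p = nabla (E s) Y p" if "s \<in> I" for s
    by (rule nabla_cong[OF frame_open[OF F] frame_VF[OF F that] assms(1) p refl assms(2)])
  then show ?thesis
    unfolding divergence_frame[OF F assms(1) p] divergence_frame[OF F Y p] by simp
qed

lemma divergence_sum:
  assumes "\<And>i. i \<in> J \<Longrightarrow> X i \<in> VF U"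
  shows "divergence M nabla (\<Sum>i\<in>J. X i) p = (\<Sum>i\<in>J. divergence M nabla (X i) p)"
proof -
  note U = frame_open[OF F]
  have "g p (nabla (E s) (\<Sum>i\<in>J. X i) p) (E s p) = (\<Sum>i\<in>J. g p (nabla (E s) (X i) p) (E s p))"
    if s: "s \<in> I" for s
  proof -
    have "nabla (E s) (\<Sum>i\<in>J. X i) p = (\<Sum>i\<in>J. nabla (E s) (X i) p)"
      by (rule nabla_sum_right[OF U assms frame_VF[OF F s] p])
    moreover have "g p (\<Sum>i\<in>J. nabla (E s) (X i) p) (E s p) = (\<Sum>i\<in>J. g p (nabla (E s) (X i) p) (E s p))"
      by (rule g_sum_left[OF frame_topspace[OF F p] frame_TM[OF F s p]])
        (rule nabla_VF_TM[OF U frame_VF[OF F s] assms p])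
    ultimately show ?thesis by simp
  qed
  then have "divergence M nabla (\<Sum>i\<in>J. X i) p = (\<Sum>s\<in>I. \<Sum>i\<in>J. g p (nabla (E s) (X i) p) (E s p))"
    using divergence_frame[OF F VF_sum[OF U, of J X] p] assms by simp
  also have "\<dots> = (\<Sum>i\<in>J. divergence M nabla (X i) p)"
    using divergence_frame[OF F assms p] by (subst sum.swap) simp
  finally show ?thesis .
qed

lemma divergence_add:
  assumes "X \<in> VF U" "Y \<in> VF U"
  shows "divergence M nabla (X + Y) p = divergence M nabla X p + divergence M nabla Y p"
  using divergence_sum[of "{True, False}" "\<lambda>b. if b then X else Y"] assms by simp

end

text \<open>The frames chosen for the single \<open>D i\<close> are restricted to a common
  neighbourhood and joined, with pairs as indices. Pairwise orthogonality makes the union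
  orthonormal, and the dimensions add up to \<open>CARD('n)\<close>, so it spans
  \<open>TM\<close>.\<close>

lemma adapted_frame:
  assumes "almost_product M k D" and p: "p \<in> topspace (topol M)"
  obtains U d where "p \<in> U"
    and "\<And>i. i \<in> {1..k} \<Longrightarrow> dim (D i p) = d i"
    and "frame_on TM U (SIGMA i:{1..k}. {..<d i}) (\<lambda>(i, a). frame_at M (D i) p a)"
    and "\<And>Q q. Q \<subseteq> {1..k} \<Longrightarrow> q \<in> U \<Longrightarrow>
      sum_distr D Q q = span ((\<lambda>x. (case x of (i, a) \<Rightarrow> frame_at M (D i) p a) q) ` (SIGMA i:Q. {..<d i}))"
proof -
  have "\<exists>d :: nat \<Rightarrow> nat. (\<forall>i\<in>{1..k}. distribution M (d i) (D i)) \<and> (\<Sum>i=1..k. d i) = CARD('n)"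
    and orth: "\<forall>i\<in>{1..k}. \<forall>j\<in>{1..k}. i \<noteq> j \<longrightarrow>
        (\<forall>p\<in>topspace (topol M). \<forall>u\<in>D i p. \<forall>v\<in>D j p. g p u v = 0)"
    using assms(1) unfolding almost_product_def by blast+
  then obtain d where d: "\<And>i. i \<in> {1..k} \<Longrightarrow> distribution M (d i) (D i)" "(\<Sum>i=1..k. d i) = CARD('n)"
    by blast
  have "\<exists>V. p \<in> V \<and> frame_on (D i) V {..<d i} (frame_at M (D i) p)" if "i \<in> {1..k}" for i
    using distribution_frame_at[OF d(1)[OF that] p] by blast
  then obtain V where V: "\<And>i. i \<in> {1..k} \<Longrightarrow> p \<in> V i"
    "\<And>i. i \<in> {1..k} \<Longrightarrow> frame_on (D i) (V i) {..<d i} (frame_at M (D i) p)"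
    by metis
  \<comment> \<open>Intersecting with the whole space keeps the set inside the manifold even for an
    empty range of \<open>i\<close>.\<close>
  define U where "U = (\<Inter>i\<in>{1..k}. V i) \<inter> topspace (topol M)"
  have oU: "opn U"
    unfolding U_def by (rule openin_INT) (use V(2) in \<open>auto intro: frame_onD(1)\<close>)
  have pU: "p \<in> U" using p V(1) by (auto simp: U_def)
  have FU: "frame_on (D i) U {..<d i} (frame_at M (D i) p)" if "i \<in> {1..k}" for i
    by (rule frame_on_subset[OF V(2)[OF that] oU]) (use that in \<open>auto simp: U_def\<close>)
  define I where "I = (SIGMA i:{1..k}. {..<d i})"
  define E where "E = (\<lambda>(i, a). frame_at M (D i) p a)"
  have E_D: "E (i, a) q \<in> D i q" if "q \<in> U" "i \<in> {1..k}" "a < d i" for i a q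
  proof -
    have "E (i, a) q \<in> (\<lambda>a. frame_at M (D i) p a q) ` {..<d i}" using that(3) by (auto simp: E_def)
    from span_base[OF this] show ?thesis using frame_onD(4)[OF FU[OF that(2)] that(1)] by simp
  qed
  have VFE: "E x \<in> VF U" if "x \<in> I" for x
    using that frame_onD(2)[OF FU] by (auto simp: I_def E_def)
  have o: "orthonormal_at q I (\<lambda>x. E x q)" if q: "q \<in> U" for q
    unfolding orthonormal_at_def
  proof (intro conjI ballI)
    show "q \<in> topspace (topol M)" using q by (simp add: U_def)
    show "finite I" by (simp add: I_def)
    show "E x q \<in> TM q" if "x \<in> I" for x by (rule VF_TM[OF VFE[OF that] q])
    fix x y assume xy: "x \<in> I" "y \<in> I"
    obtain i a j b where x: "x = (i, a)" "i \<in> {1..k}" "a < d i" and y: "y = (j, b)" "j \<in> {1..k}" "b < d j"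
      using xy by (auto simp: I_def)
    show "g q (E x q) (E y q) = (if x = y then 1 else 0)"
    proof (cases "i = j")
      case True
      then show ?thesis
        using orthonormal_atD(4)[OF frame_onD(3)[OF FU[OF x(2)] q], of a b] x y by (simp add: E_def)
    next
      case False
      then have "g q (E x q) (E y q) = 0"
        using orth[rule_format, OF x(2) y(2) False \<open>q \<in> topspace (topol M)\<close> E_D[OF q x(2,3)] E_D[OF q y(2,3)]]
        by (simp add: x(1) y(1))
      then show ?thesis using False x y by simp
    qed
  qed
  have "card I = CARD('n)" unfolding I_def using d(2) by simp
  then have full: "span ((\<lambda>x. E x q) ` I) = TM q" if "q \<in> U" for q
    using orthonormal_at_full[OF o[OF that]] by simp
  have FI: "frame_on TM U I E"
    unfolding frame_on_def using oU VFE o full by blast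
  have "sum_distr D Q q = span ((\<lambda>x. E x q) ` (SIGMA i:Q. {..<d i}))" if Q: "Q \<subseteq> {1..k}" and q: "q \<in> U" for Q q
  proof -
    have "D i q = span ((\<lambda>a. E (i, a) q) ` {..<d i})" if "i \<in> Q" for i
      using frame_onD(4)[OF FU q] that Q by (auto simp: E_def)
    then have "sum_distr D Q q = span (\<Union>i\<in>Q. span ((\<lambda>a. E (i, a) q) ` {..<d i}))"
      by (simp add: sum_distr_def)
    also have "\<dots> = span (\<Union>i\<in>Q. (\<lambda>a. E (i, a) q) ` {..<d i})"
      by (rule span_Union_span)
    also have "(\<Union>i\<in>Q. (\<lambda>a. E (i, a) q) ` {..<d i}) = (\<lambda>x. E x q) ` (SIGMA i:Q. {..<d i})"
      by force
    finally show ?thesis .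
  qed
  moreover have "dim (D i p) = d i" if "i \<in> {1..k}" for i
    using frame_on_dim[OF FU[OF that] pU] by simp
  ultimately show ?thesis
    using that[of U d] pU FI unfolding I_def E_def by blast
qed

lemma divergence_mean_curvature_sum:
  assumes k: "1 \<le> k" and AP: "almost_product M k D" and p: "p \<in> topspace (topol M)"
  defines "L \<equiv> \<lambda>Q. form_norm2 M (sum_distr D Q) (second_fundamental_form M nabla (sum_distr D Q)) p
    - g p (mean_curvature M nabla (sum_distr D Q) p) (mean_curvature M nabla (sum_distr D Q) p)
    - form_norm2 M (sum_distr D Q) (integrability_tensor M nabla (sum_distr D Q)) p"
  shows "divergence M nabla (\<Sum>i=1..k. mean_curvature M nabla (sum_distr D {i})
        + mean_curvature M nabla (sum_distr D ({1..k} - {i}))) p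
    = 2 * mixed_scalar_curvature M nabla k D p + (\<Sum>i=1..k. L {i} + L ({1..k} - {i}))"
proof -
  define E where "E = (\<lambda>(i, a). frame_at M (D i) p a)"
  obtain U d where pU: "p \<in> U" and dimD: "\<And>i. i \<in> {1..k} \<Longrightarrow> dim (D i p) = d i"
    and F0: "frame_on TM U (SIGMA i:{1..k}. {..<d i}) E"
    and SD0: "\<And>Q q. Q \<subseteq> {1..k} \<Longrightarrow> q \<in> U \<Longrightarrow> sum_distr D Q q = span ((\<lambda>x. E x q) ` (SIGMA i:Q. {..<d i}))"
    unfolding E_def using adapted_frame[OF AP p] by blast
  \<comment> \<open>\<open>A Q\<close> collects the frame indices of \<open>sum_distr D Q\<close>;
    complements in \<open>{1..k}\<close> become complements in \<open>I\<close>.\<close>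
  define A where "A = (\<lambda>Q. SIGMA i:Q. {..<d i})"
  define I where "I = A {1..k}"
  have F: "frame_on TM U I E" using F0 by (simp add: A_def I_def)
  have SD: "sum_distr D Q q = span ((\<lambda>x. E x q) ` A Q)" if "Q \<subseteq> {1..k}" "q \<in> U" for Q q
    unfolding A_def by (rule SD0[OF that])
  note U = frame_open[OF F]
  have AI: "A Q \<subseteq> I" if "Q \<subseteq> {1..k}" for Q using that by (auto simp: A_def I_def)
  have compl: "I - A Q = A ({1..k} - Q)" for Q by (auto simp: A_def I_def)
  define H where "H = (\<lambda>Q. mean_curvature M nabla (sum_distr D Q))"
  have H: "H Q q = mean_field I E (A Q) q" if "Q \<subseteq> {1..k}" "q \<in> U" for Q q
    unfolding H_def mean_field_apply[OF F] by (rule mean_curvature_frame[OF F AI[OF that(1)] SD[OF that(1)] that(2)])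
  have H_VF: "H Q \<in> VF U" if "Q \<subseteq> {1..k}" for Q
    by (rule VF_cong[OF U mean_field_VF[OF F AI[OF that]]]) (simp add: H[OF that])
  have divH: "divergence M nabla (H Q) p = divergence M nabla (mean_field I E (A Q)) p"
    if "Q \<subseteq> {1..k}" for Q
    by (rule divergence_cong[OF F pU H_VF[OF that] H[OF that]])
  have L: "L Q = (\<Sum>z\<in>I - A Q. \<Sum>s\<in>A Q. \<Sum>t\<in>A Q. conn E s t z p * conn E t s z p)
      - (\<Sum>z\<in>I - A Q. (\<Sum>s\<in>A Q. conn E s s z p)\<^sup>2)" if Q: "Q \<subseteq> {1..k}" for Q
    using form_norm2_diff_frame[OF F AI[OF Q] SD[OF Q] pU]
      mean_curvature_norm2_frame[OF F AI[OF Q] SD[OF Q] pU]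
    unfolding L_def by simp
  define K where "K = (\<lambda>x y. g p (curvature M nabla (E x) (E y) (E x) p) (E y p))"
  have walczak: "divergence M nabla (H {i} + H ({1..k} - {i})) p
      = (\<Sum>x\<in>A {i}. \<Sum>y\<in>A ({1..k} - {i}). K x y) + (L {i} + L ({1..k} - {i}))" if i: "i \<in> {1..k}" for i
  proof -
    have Q: "{i} \<subseteq> {1..k}" "{1..k} - {i} \<subseteq> {1..k}" using i by auto
    have c: "I - A ({1..k} - {i}) = A {i}" using i by (auto simp: A_def I_def)
    show ?thesis
      unfolding divergence_add[OF F pU H_VF[OF Q(1)] H_VF[OF Q(2)]] divH[OF Q(1)] divH[OF Q(2)] L[OF Q(1)] L[OF Q(2)] c
      using walczak_frame[OF F AI[OF Q(1)] pU] unfolding compl K_def by simp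
  qed
  have sum_A: "sum f (A Q) = (\<Sum>j\<in>Q. \<Sum>b<d j. f (j, b))" if "finite Q" for f :: "nat \<times> nat \<Rightarrow> real" and Q
    unfolding A_def using sum.Sigma[of Q "\<lambda>j. {..<d j}" "\<lambda>j b. f (j, b)"] that by simp
  \<comment> \<open>At \<open>p\<close> the frame \<open>E\<close> consists of the very frames in
    \<open>mixed_curvature\<close>, so this is an unfolding without change of frame.\<close>
  have mixed: "mixed_curvature M nabla (D i) (D j) p = (\<Sum>a<d i. \<Sum>b<d j. K (i, a) (j, b))"
    if "i \<in> {1..k}" "j \<in> {1..k}" for i j
    unfolding mixed_curvature_def Let_def dimD[OF that(1)] dimD[OF that(2)] K_def E_def by simp
  have mixed_sym: "mixed_curvature M nabla (D i) (D j) p = mixed_curvature M nabla (D j) (D i) p"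
    if ij: "i \<in> {1..k}" "j \<in> {1..k}" for i j
  proof -
    have "K (i, a) (j, b) = K (j, b) (i, a)" if "a < d i" "b < d j" for a b
      unfolding K_def by (rule curvature_frame_sym[OF F pU]) (use ij that in \<open>auto simp: A_def I_def\<close>)
    then show ?thesis
      unfolding mixed[OF ij] mixed[OF ij(2,1)] by (subst sum.swap) simp
  qed
  \<comment> \<open>The normal indices of \<open>D i\<close> are grouped by the distribution
    \<open>D j\<close> to which they belong.\<close>
  have "(\<Sum>x\<in>A {i}. \<Sum>y\<in>A ({1..k} - {i}). K x y) = (\<Sum>j\<in>{1..k} - {i}. mixed_curvature M nabla (D i) (D j) p)"
    if i: "i \<in> {1..k}" for i
  proof -
    have "(\<Sum>x\<in>A {i}. \<Sum>y\<in>A ({1..k} - {i}). K x y) = (\<Sum>a<d i. \<Sum>j\<in>{1..k} - {i}. \<Sum>b<d j. K (i, a) (j, b))"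
      by (simp add: sum_A)
    also have "\<dots> = (\<Sum>j\<in>{1..k} - {i}. \<Sum>a<d i. \<Sum>b<d j. K (i, a) (j, b))" by (rule sum.swap)
    finally show ?thesis using mixed[OF i] by simp
  qed
  then have Smix: "(\<Sum>i=1..k. \<Sum>x\<in>A {i}. \<Sum>y\<in>A ({1..k} - {i}). K x y) = 2 * mixed_scalar_curvature M nabla k D p"
    unfolding mixed_scalar_curvature_def using sum_off_diagonal_symmetric[OF mixed_sym] by simp
  have "divergence M nabla (\<Sum>i=1..k. H {i} + H ({1..k} - {i})) p
      = (\<Sum>i=1..k. divergence M nabla (H {i} + H ({1..k} - {i})) p)"
    by (rule divergence_sum[OF F pU]) (intro VF_add[OF U] H_VF; auto)
  then show ?thesis
    using walczak Smix by (simp add: H_def sum.distrib)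
qed

end

theorem theorem1:
  fixes M :: "('a, 'n::finite) riem"
    and nabla :: "('a, 'n) vfield \<Rightarrow> ('a, 'n) vfield \<Rightarrow> ('a, 'n) vfield"
    and D :: "nat \<Rightarrow> ('a, 'n) distr"
    and k :: nat
    and X :: "('a, 'n) vfield"
  assumes "2 \<le> k" and "k \<le> CARD('n)"
    and "almost_product M k D"
    and "levi_civita_connection M nabla"
    and "X = (\<Sum>r\<leftarrow>[1, k - 1]. \<Sum>q\<in>index_sets r k. mean_curvature M nabla (sum_distr D q))"
  shows "\<forall>p\<in>topspace (topol M).
    divergence M nabla X p =
      2 * mixed_scalar_curvature M nabla k D p +
      (\<Sum>r\<leftarrow>[1, k - 1]. \<Sum>q\<in>index_sets r k.
          form_norm2 M (sum_distr D q) (second_fundamental_form M nabla (sum_distr D q)) p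
        - metric M p (mean_curvature M nabla (sum_distr D q) p) (mean_curvature M nabla (sum_distr D q) p)
        - form_norm2 M (sum_distr D q) (integrability_tensor M nabla (sum_distr D q)) p)"
proof
  fix p assume p: "p \<in> topspace (topol M)"
  interpret riemannian_connection M nabla
    using assms(3,4) by unfold_locales (simp_all add: almost_product_def)
  have k: "1 \<le> k" using assms(1) by simp
  show "divergence M nabla X p =
      2 * mixed_scalar_curvature M nabla k D p +
      (\<Sum>r\<leftarrow>[1, k - 1]. \<Sum>q\<in>index_sets r k.
          form_norm2 M (sum_distr D q) (second_fundamental_form M nabla (sum_distr D q)) p
        - metric M p (mean_curvature M nabla (sum_distr D q) p) (mean_curvature M nabla (sum_distr D q) p)
        - form_norm2 M (sum_distr D q) (integrability_tensor M nabla (sum_distr D q)) p)"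
    unfolding assms(5) sum_index_sets[OF k] by (rule divergence_mean_curvature_sum[OF k assms(3) p])
qed

end
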